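(* Let $(R,\Omega)$ be an $\Omega$-operated algebra and let $X$ be a set. Let $M_R(X)$ and the family $\mathfrak{m}'_\Omega=(\mathfrak{m}'_\omega)_{\omega\in\Omega}$ be as defined in the context. Then: (a) $(M_R(X),\mathfrak{m}'_\Omega)$ is a left $\Omega$-operated module. (b) With the set map $j_X:X\to M_R(X)$, $x\mapsto \mathbf{1}_R\otimes x$, $(M_R(X),\mathfrak{m}'_\Omega)$ is the free left $\Omega$-operated module on $X$.
   Context: $\mathbf{k}$ is a commutative unital ring; algebras are associative unital $\mathbf{k}$-algebras, modules are unital, "linear" means $\mathbf{k}$-linear, $\otimes=\otimes_{\mathbf{k}}$. $\Omega$ is a nonempty set. For a set $Y$, $\mathbf{k}Y$ is the free $\mathbf{k}$-module on $Y$. An $\Omega$-operated algebra $(R,\Omega)$ is an algebra $R$ equipped with a family, indexed by $\omega\in\Omega$, of linear operators $R\to R$ (no identity is imposed). A left $\Omega$-operated module $(M,(\mathfrak{m}_\omega)_{\omega\in\Omega})$ over it is a left $R$-module $M$ with a family of $\mathbf{k}$-linear operators $\mathfrak{m}_\omega:M\to M$. A homomorphism $(M,(\mathfrak{m}_\omega))\to(N,(\mathfrak{n}_\omega))$ of left $\Omega$-operated modules is a left $R$-module homomorphism $\phi$ with $\phi\circ\mathfrak{m}_\omega=\mathfrak{n}_\omega\circ\phi$ for all $\omega\in\Omega$. A free left $\Omega$-operated module on $X$ is a left $\Omega$-operated module $(M,(\mathfrak{m}_\omega))$ with a set map $j_X:X\to M$ such that for every left $\Omega$-operated module $(N,(\mathfrak{n}_\omega))$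 and every set map $f:X\to N$ there is a unique left $\Omega$-operated module homomorphism $\overline f:M\to N$ with $\overline f\circ j_X=f$. Construction: put $M_1(X)=R\otimes\mathbf{k}X$ and $M_n(X)=M_1(X)\oplus (R\otimes\mathbf{k}\Omega\otimes M_{n-1}(X))$ for $n\ge 2$, with the evident inclusions $M_{n-1}(X)\subseteq M_n(X)$, and $M_R(X)=\bigcup_{n\ge1}M_n(X)$; equivalently $M_R(X)=\bigoplus_{n\ge 1}(R\otimes\mathbf{k}\Omega)^{\otimes(n-1)}\otimes R\otimes\mathbf{k}X$, spanned by pure tensors $r_1\otimes\omega_1\otimes\cdots\otimes r_{n-1}\otimes\omega_{n-1}\otimes r_n\otimes x$ with $r_i\in R,\omega_i\in\Omega,x\in X$. $R$ acts by left multiplication on the first tensor factor: $r(r_1\otimes\omega_1\otimes\cdots\otimes r_n\otimes x)=rr_1\otimes\omega_1\otimes\cdots\otimes r_n\otimes x$. The operator $\mathfrak{m}'_\omega:M_R(X)\to M_R(X)$ is the additive extension of $r_1\otimes\omega_1\otimes\cdots\otimes r_n\otimes x\mapsto \mathbf{1}_R\otimes\omega\otimes r_1\otimes\omega_1\otimes\cdots\otimes r_n\otimes x$. *)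

theory Defs
  imports "HOL-Algebra.Module" "HOL-Algebra.AbelCoset"
begin

section \<open>Constructions with modules over a commutative ring\<close>

text \<open>
  Modules are HOL-Algebra module records. Their inherited \<open>mult\<close> and \<open>one\<close> fields carry no
  meaning for a module and are set to \<open>undefined\<close> where a record is built.
\<close>

definition direct_sum :: "'i set \<Rightarrow> ('i \<Rightarrow> ('k, 'm) module) \<Rightarrow> ('k, 'i \<Rightarrow> 'm) module" where
  "direct_sum I M =
    \<lparr>carrier = {f \<in> (\<Pi>\<^sub>E i\<in>I. carrier (M i)). finite {i \<in> I. f i \<noteq> \<zero>\<^bsub>M i\<^esub>}},
     mult = undefined, one = undefined,
     zero = (\<lambda>i\<in>I. \<zero>\<^bsub>M i\<^esub>),
     add = (\<lambda>f g. \<lambda>i\<in>I. f i \<oplus>\<^bsub>M i\<^esub> g i),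
     smult = (\<lambda>c f. \<lambda>i\<in>I. c \<odot>\<^bsub>M i\<^esub> f i)\<rparr>"

definition regular_module :: "('k, 'c) ring_scheme \<Rightarrow> ('k, 'k) module" where
  "regular_module K =
    \<lparr>carrier = carrier K, mult = undefined, one = undefined,
     zero = \<zero>\<^bsub>K\<^esub>, add = (\<lambda>x y. x \<oplus>\<^bsub>K\<^esub> y), smult = (\<lambda>c x. c \<otimes>\<^bsub>K\<^esub> x)\<rparr>"

definition free_module :: "('k, 'c) ring_scheme \<Rightarrow> 'y set \<Rightarrow> ('k, 'y \<Rightarrow> 'k) module" where
  "free_module K Y = direct_sum Y (\<lambda>_. regular_module K)"

definition basis_elem :: "('k, 'c) ring_scheme \<Rightarrow> 'y set \<Rightarrow> 'y \<Rightarrow> 'y \<Rightarrow> 'k" where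
  "basis_elem K Y y = (\<lambda>z\<in>Y. if z = y then \<one>\<^bsub>K\<^esub> else \<zero>\<^bsub>K\<^esub>)"

definition generated_submodule ::
    "('k, 'c) ring_scheme \<Rightarrow> ('k, 'm, 'd) module_scheme \<Rightarrow> 'm set \<Rightarrow> 'm set" where
  "generated_submodule K M A = \<Inter> {H. submodule H K M \<and> A \<subseteq> H}"

definition quotient_module ::
    "('k, 'm, 'd) module_scheme \<Rightarrow> 'm set \<Rightarrow> ('k, 'm set) module" where
  "quotient_module M S =
    \<lparr>carrier = a_rcosets\<^bsub>M\<^esub> S, mult = undefined, one = undefined,
     zero = S, add = set_add M,
     smult = (\<lambda>c A. \<Union>x\<in>A. S +>\<^bsub>M\<^esub> (c \<odot>\<^bsub>M\<^esub> x))\<rparr>"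

text \<open>
  The tensor product over \<open>K\<close> of the modules in a list: the free module on the tuples
  modulo the submodule generated by the multilinearity relations in every slot.
\<close>

definition tensor_tuples :: "('k, 'm) module list \<Rightarrow> 'm list set" where
  "tensor_tuples Ms = listset (map carrier Ms)"

definition multilinear_relations ::
    "('k, 'c) ring_scheme \<Rightarrow> ('k, 'm) module list \<Rightarrow> ('m list \<Rightarrow> 'k) set" where
  "multilinear_relations K Ms =
    (let T = tensor_tuples Ms; F = free_module K T; e = basis_elem K T in
      {e (t[i := a \<oplus>\<^bsub>Ms ! i\<^esub> b]) \<ominus>\<^bsub>F\<^esub> (e (t[i := a]) \<oplus>\<^bsub>F\<^esub> e (t[i := b])) | t i a b.
         t \<in> T \<and> i < length Ms \<and> a \<in> carrier (Ms ! i) \<and> b \<in> carrier (Ms ! i)} \<union>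
      {e (t[i := c \<odot>\<^bsub>Ms ! i\<^esub> a]) \<ominus>\<^bsub>F\<^esub> (c \<odot>\<^bsub>F\<^esub> e (t[i := a])) | t i c a.
         t \<in> T \<and> i < length Ms \<and> c \<in> carrier K \<and> a \<in> carrier (Ms ! i)})"

definition tensor_null ::
    "('k, 'c) ring_scheme \<Rightarrow> ('k, 'm) module list \<Rightarrow> ('m list \<Rightarrow> 'k) set" where
  "tensor_null K Ms =
    generated_submodule K (free_module K (tensor_tuples Ms)) (multilinear_relations K Ms)"

definition tensor_product ::
    "('k, 'c) ring_scheme \<Rightarrow> ('k, 'm) module list \<Rightarrow> ('k, ('m list \<Rightarrow> 'k) set) module" where
  "tensor_product K Ms = quotient_module (free_module K (tensor_tuples Ms)) (tensor_null K Ms)"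

definition pure_tensor ::
    "('k, 'c) ring_scheme \<Rightarrow> ('k, 'm) module list \<Rightarrow> 'm list \<Rightarrow> ('m list \<Rightarrow> 'k) set" where
  "pure_tensor K Ms t =
    tensor_null K Ms +>\<^bsub>free_module K (tensor_tuples Ms)\<^esub> basis_elem K (tensor_tuples Ms) t"

text \<open>
  The linear extension to the tensor product of a map \<open>F\<close> prescribed on tuples, i.e. on pure
  tensors. If \<open>F\<close> is multilinear, then the value does not depend on the representative \<open>f\<close> of
  the class \<open>A\<close>.
\<close>

definition tensor_lift ::
    "('k, 'c) ring_scheme \<Rightarrow> ('k, 'm) module list \<Rightarrow> ('k, 'n) module \<Rightarrow>
     ('m list \<Rightarrow> 'n) \<Rightarrow> ('m list \<Rightarrow> 'k) set \<Rightarrow> 'n" where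
  "tensor_lift K Ms N F A =
    (let f = (SOME f. f \<in> A)
     in \<Oplus>\<^bsub>N\<^esub>t\<in>{t \<in> tensor_tuples Ms. f t \<noteq> \<zero>\<^bsub>K\<^esub>}. f t \<odot>\<^bsub>N\<^esub> F t)"


section \<open>Operated algebras and operated modules\<close>

text \<open>
  The library locale \<open>algebra\<close> covers only commutative algebras, and \<open>module\<close> only modules
  over commutative rings.
\<close>

locale assoc_algebra = module K R + ring R
  for K :: "('k, 'c) ring_scheme" and R :: "('k, 'r, 'd) module_scheme" +
  assumes smult_mult_left:
      "\<lbrakk>c \<in> carrier K; x \<in> carrier R; y \<in> carrier R\<rbrakk> \<Longrightarrow>
        (c \<odot>\<^bsub>R\<^esub> x) \<otimes>\<^bsub>R\<^esub> y = c \<odot>\<^bsub>R\<^esub> (x \<otimes>\<^bsub>R\<^esub> y)"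
    and smult_mult_right:
      "\<lbrakk>c \<in> carrier K; x \<in> carrier R; y \<in> carrier R\<rbrakk> \<Longrightarrow>
        x \<otimes>\<^bsub>R\<^esub> (c \<odot>\<^bsub>R\<^esub> y) = c \<odot>\<^bsub>R\<^esub> (x \<otimes>\<^bsub>R\<^esub> y)"

locale left_module = R?: ring R + M?: abelian_group M
  for R :: "('r, 'd) ring_scheme" and M :: "('r, 'm, 'e) module_scheme" +
  assumes smult_closed:
      "\<lbrakk>a \<in> carrier R; x \<in> carrier M\<rbrakk> \<Longrightarrow> a \<odot>\<^bsub>M\<^esub> x \<in> carrier M"
    and smult_l_distr:
      "\<lbrakk>a \<in> carrier R; b \<in> carrier R; x \<in> carrier M\<rbrakk> \<Longrightarrow>
        (a \<oplus>\<^bsub>R\<^esub> b) \<odot>\<^bsub>M\<^esub> x = a \<odot>\<^bsub>M\<^esub> x \<oplus>\<^bsub>M\<^esub> b \<odot>\<^bsub>M\<^esub> x"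
    and smult_r_distr:
      "\<lbrakk>a \<in> carrier R; x \<in> carrier M; y \<in> carrier M\<rbrakk> \<Longrightarrow>
        a \<odot>\<^bsub>M\<^esub> (x \<oplus>\<^bsub>M\<^esub> y) = a \<odot>\<^bsub>M\<^esub> x \<oplus>\<^bsub>M\<^esub> a \<odot>\<^bsub>M\<^esub> y"
    and smult_assoc1:
      "\<lbrakk>a \<in> carrier R; b \<in> carrier R; x \<in> carrier M\<rbrakk> \<Longrightarrow>
        (a \<otimes>\<^bsub>R\<^esub> b) \<odot>\<^bsub>M\<^esub> x = a \<odot>\<^bsub>M\<^esub> (b \<odot>\<^bsub>M\<^esub> x)"
    and smult_one:
      "x \<in> carrier M \<Longrightarrow> \<one>\<^bsub>R\<^esub> \<odot>\<^bsub>M\<^esub> x = x"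

definition linear_operator ::
    "('k, 'c) ring_scheme \<Rightarrow> ('k, 'm, 'd) module_scheme \<Rightarrow> ('m \<Rightarrow> 'm) \<Rightarrow> bool" where
  "linear_operator K M h \<longleftrightarrow>
    h \<in> carrier M \<rightarrow> carrier M \<and>
    (\<forall>x\<in>carrier M. \<forall>y\<in>carrier M. h (x \<oplus>\<^bsub>M\<^esub> y) = h x \<oplus>\<^bsub>M\<^esub> h y) \<and>
    (\<forall>c\<in>carrier K. \<forall>x\<in>carrier M. h (c \<odot>\<^bsub>M\<^esub> x) = c \<odot>\<^bsub>M\<^esub> h x)"

locale operated_algebra = assoc_algebra K R
  for K :: "('k, 'c) ring_scheme" and R :: "('k, 'r, 'd) module_scheme" +
  fixes \<Omega> :: "'w set" and P :: "'w \<Rightarrow> 'r \<Rightarrow> 'r"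
  assumes operator_linear: "\<omega> \<in> \<Omega> \<Longrightarrow> linear_operator K R (P \<omega>)"

text \<open>
  A left module \<open>M\<close> over the \<open>K\<close>-algebra \<open>R\<close>, regarded as a \<open>K\<close>-module through the structure
  map \<open>c \<mapsto> c \<odot> \<one>\<close>.
\<close>

definition restrict_scalars ::
    "('k, 'r, 'd) module_scheme \<Rightarrow> ('r, 'm, 'e) module_scheme \<Rightarrow> ('k, 'm) module" where
  "restrict_scalars R M =
    \<lparr>carrier = carrier M, mult = undefined, one = undefined,
     zero = \<zero>\<^bsub>M\<^esub>, add = (\<lambda>x y. x \<oplus>\<^bsub>M\<^esub> y),
     smult = (\<lambda>c x. (c \<odot>\<^bsub>R\<^esub> \<one>\<^bsub>R\<^esub>) \<odot>\<^bsub>M\<^esub> x)\<rparr>"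

definition operated_module ::
    "('k, 'c) ring_scheme \<Rightarrow> ('k, 'r, 'd) module_scheme \<Rightarrow> 'w set \<Rightarrow>
     ('r, 'm, 'e) module_scheme \<Rightarrow> ('w \<Rightarrow> 'm \<Rightarrow> 'm) \<Rightarrow> bool" where
  "operated_module K R \<Omega> M \<mm> \<longleftrightarrow>
    left_module R M \<and> (\<forall>\<omega>\<in>\<Omega>. linear_operator K (restrict_scalars R M) (\<mm> \<omega>))"

definition operated_hom ::
    "('k, 'r, 'd) module_scheme \<Rightarrow> 'w set \<Rightarrow>
     ('r, 'm, 'e) module_scheme \<Rightarrow> ('w \<Rightarrow> 'm \<Rightarrow> 'm) \<Rightarrow>
     ('r, 'n, 'f) module_scheme \<Rightarrow> ('w \<Rightarrow> 'n \<Rightarrow> 'n) \<Rightarrow> ('m \<Rightarrow> 'n) set" where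
  "operated_hom R \<Omega> M \<mm> N \<nn> =
    {\<phi> \<in> carrier M \<rightarrow> carrier N.
      (\<forall>x\<in>carrier M. \<forall>y\<in>carrier M. \<phi> (x \<oplus>\<^bsub>M\<^esub> y) = \<phi> x \<oplus>\<^bsub>N\<^esub> \<phi> y) \<and>
      (\<forall>r\<in>carrier R. \<forall>x\<in>carrier M. \<phi> (r \<odot>\<^bsub>M\<^esub> x) = r \<odot>\<^bsub>N\<^esub> \<phi> x) \<and>
      (\<forall>\<omega>\<in>\<Omega>. \<forall>x\<in>carrier M. \<phi> (\<mm> \<omega> x) = \<nn> \<omega> (\<phi> x))}"

text \<open>
  HOL cannot quantify over types inside a formula, so the element type \<open>'n\<close> of the test modules
  is a parameter; a theorem in which \<open>'n\<close> is a type variable occurring nowhere else states the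
  universal property for all test modules. The restriction to \<open>extensional\<close> maps makes \<open>\<phi>\<close>
  unique as a map on \<open>carrier M\<close>.
\<close>

definition free_operated_module ::
    "'n itself \<Rightarrow> ('k, 'c) ring_scheme \<Rightarrow> ('k, 'r, 'd) module_scheme \<Rightarrow> 'w set \<Rightarrow> 'x set \<Rightarrow>
     ('r, 'm, 'e) module_scheme \<Rightarrow> ('w \<Rightarrow> 'm \<Rightarrow> 'm) \<Rightarrow> ('x \<Rightarrow> 'm) \<Rightarrow> bool" where
  "free_operated_module (_ :: 'n itself) K R \<Omega> X M \<mm> j \<longleftrightarrow>
    operated_module K R \<Omega> M \<mm> \<and> j \<in> X \<rightarrow> carrier M \<and>
    (\<forall>(N :: ('r, 'n) module) \<nn> f.
      operated_module K R \<Omega> N \<nn> \<and> f \<in> X \<rightarrow> carrier N \<longrightarrow>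
      (\<exists>!\<phi>. \<phi> \<in> extensional (carrier M) \<and> \<phi> \<in> operated_hom R \<Omega> M \<mm> N \<nn> \<and>
             (\<forall>x\<in>X. \<phi> (j x) = f x)))"


section \<open>The module \<open>M\<^sub>R(X)\<close>\<close>

text \<open>
  \<open>tensor_product\<close> takes modules over one element type, so the factors \<open>R\<close>, \<open>K\<Omega>\<close> and \<open>KX\<close> are
  copied into a common type along its (injective) constructors.
\<close>

datatype ('r, 'w, 'x, 'k) slot =
  Alg (the_alg: 'r) | Op (the_op: "'w \<Rightarrow> 'k") | Gen (the_gen: "'x \<Rightarrow> 'k")

definition module_copy :: "('a \<Rightarrow> 'b) \<Rightarrow> ('k, 'a, 'd) module_scheme \<Rightarrow> ('k, 'b) module" where
  "module_copy h A =
    \<lparr>carrier = h ` carrier A, mult = undefined, one = undefined,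
     zero = h \<zero>\<^bsub>A\<^esub>,
     add = (\<lambda>u v. h (inv_into UNIV h u \<oplus>\<^bsub>A\<^esub> inv_into UNIV h v)),
     smult = (\<lambda>c u. h (c \<odot>\<^bsub>A\<^esub> inv_into UNIV h u))\<rparr>"

text \<open>
  The factors \<open>R, K\<Omega>, \<dots>, R, K\<Omega>, R, KX\<close>, with \<open>n - 1\<close> pairs \<open>R, K\<Omega>\<close>, of the degree-\<open>n\<close> summand
  of \<open>M\<^sub>R(X)\<close>, for \<open>n \<ge> 1\<close>.
\<close>

definition factors ::
    "('k, 'c) ring_scheme \<Rightarrow> ('k, 'r, 'd) module_scheme \<Rightarrow> 'w set \<Rightarrow> 'x set \<Rightarrow> nat \<Rightarrow>
     ('k, ('r, 'w, 'x, 'k) slot) module list" where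
  "factors K R \<Omega> X n =
    concat (replicate (n - 1) [module_copy Alg R, module_copy Op (free_module K \<Omega>)])
      @ [module_copy Alg R, module_copy Gen (free_module K X)]"

definition MR_summand ::
    "('k, 'c) ring_scheme \<Rightarrow> ('k, 'r, 'd) module_scheme \<Rightarrow> 'w set \<Rightarrow> 'x set \<Rightarrow> nat \<Rightarrow>
     ('k, (('r, 'w, 'x, 'k) slot list \<Rightarrow> 'k) set) module" where
  "MR_summand K R \<Omega> X n = tensor_product K (factors K R \<Omega> X n)"

definition MR_pure ::
    "('k, 'c) ring_scheme \<Rightarrow> ('k, 'r, 'd) module_scheme \<Rightarrow> 'w set \<Rightarrow> 'x set \<Rightarrow> nat \<Rightarrow>
     ('r, 'w, 'x, 'k) slot list \<Rightarrow> (('r, 'w, 'x, 'k) slot list \<Rightarrow> 'k) set" where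
  "MR_pure K R \<Omega> X n = pure_tensor K (factors K R \<Omega> X n)"

text \<open>
  The scalars of \<open>MR\<close> are those of \<open>R\<close>: in each degree, \<open>r\<close> acts by the linear extension of
  \<open>r\<^sub>1 \<otimes> t \<mapsto> r r\<^sub>1 \<otimes> t\<close>.
\<close>

definition MR ::
    "('k, 'c) ring_scheme \<Rightarrow> ('k, 'r, 'd) module_scheme \<Rightarrow> 'w set \<Rightarrow> 'x set \<Rightarrow>
     ('r, nat \<Rightarrow> (('r, 'w, 'x, 'k) slot list \<Rightarrow> 'k) set) module" where
  "MR K R \<Omega> X =
    (let D = direct_sum {1..} (MR_summand K R \<Omega> X) in
      \<lparr>carrier = carrier D, mult = undefined, one = undefined,
       zero = \<zero>\<^bsub>D\<^esub>, add = (\<lambda>u v. u \<oplus>\<^bsub>D\<^esub> v),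
       smult = (\<lambda>r u. \<lambda>n\<in>{1..}.
         tensor_lift K (factors K R \<Omega> X n) (MR_summand K R \<Omega> X n)
           (\<lambda>t. MR_pure K R \<Omega> X n (Alg (r \<otimes>\<^bsub>R\<^esub> the_alg (hd t)) # tl t)) (u n))\<rparr>)"

definition MR_operator ::
    "('k, 'c) ring_scheme \<Rightarrow> ('k, 'r, 'd) module_scheme \<Rightarrow> 'w set \<Rightarrow> 'x set \<Rightarrow> 'w \<Rightarrow>
     (nat \<Rightarrow> (('r, 'w, 'x, 'k) slot list \<Rightarrow> 'k) set) \<Rightarrow>
     (nat \<Rightarrow> (('r, 'w, 'x, 'k) slot list \<Rightarrow> 'k) set)" where
  "MR_operator K R \<Omega> X \<omega> u = (\<lambda>n\<in>{1..}.
    if n = 1 then \<zero>\<^bsub>MR_summand K R \<Omega> X 1\<^esub>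
    else tensor_lift K (factors K R \<Omega> X (n - 1)) (MR_summand K R \<Omega> X n)
           (\<lambda>t. MR_pure K R \<Omega> X n (Alg \<one>\<^bsub>R\<^esub> # Op (basis_elem K \<Omega> \<omega>) # t)) (u (n - 1)))"

definition MR_gen ::
    "('k, 'c) ring_scheme \<Rightarrow> ('k, 'r, 'd) module_scheme \<Rightarrow> 'w set \<Rightarrow> 'x set \<Rightarrow> 'x \<Rightarrow>
     (nat \<Rightarrow> (('r, 'w, 'x, 'k) slot list \<Rightarrow> 'k) set)" where
  "MR_gen K R \<Omega> X x = (\<lambda>n\<in>{1..}.
    if n = 1 then MR_pure K R \<Omega> X 1 [Alg \<one>\<^bsub>R\<^esub>, Gen (basis_elem K X x)]
    else \<zero>\<^bsub>MR_summand K R \<Omega> X n\<^esub>)"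

end

theory Submission
  imports Defs
begin

text \<open>
  A homomorphism out of \<open>M\<^sub>R(X)\<close> has no choice on pure tensors, since
  \<open>r\<^sub>1 \<otimes> \<omega>\<^sub>1 \<otimes> \<dots> \<otimes> r\<^sub>n \<otimes> x = r\<^sub>1 \<mm>'\<^sub>\<omega>\<^sub>1(r\<^sub>2 \<mm>'\<^sub>\<omega>\<^sub>2(\<dots> r\<^sub>n j(x)))\<close>. The operators satisfy no identity apart
  from linearity, so every choice of images for the elements of \<open>X\<close> is consistent with this formula.

  Uniqueness is therefore generation: a \<open>K\<close>-submodule that contains \<open>j(X)\<close> and is stable under \<open>R\<close>
  and the operators contains all pure tensors, by induction on their degree, and so is everything
  (\<open>MR_generated\<close>). The set where two homomorphisms agree is such a submodule.

  For existence, the right-hand side of the formula, read in a target \<open>N\<close> with \<open>f(x)\<close> in place of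
  \<open>j(x)\<close>, defines \<open>eval_word\<close>. It is multilinear in the factors (\<open>eval_word_multilinear\<close>), so it
  extends to each tensor product and then to their direct sum (\<open>MR_extension_linear\<close>). The extension
  commutes with \<open>R\<close> and the operators because this is visible on pure tensors
  (\<open>MR_extension_scale\<close>, \<open>MR_extension_operator\<close>).

  That \<open>M\<^sub>R(X)\<close> is an operated module at all is obtained in the same way: its action and operators are
  linear extensions of multilinear maps, and each law compares linear maps, which agree once they
  agree on pure tensors. All of this rests on two facts about each construction (direct sum, free
  module, tensor product): maps prescribed on its evident spanning set extend linearly when they
  are compatible with the relations, and a submodule containing that set is the whole module.
\<close>

section \<open>Linear maps and submodules\<close>

definition linear_map ::
    "('k, 'c) ring_scheme \<Rightarrow> ('k, 'm, 'd) module_scheme \<Rightarrow> ('k, 'n, 'e) module_scheme \<Rightarrow> ('m \<Rightarrow> 'n) \<Rightarrow> bool" where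
  "linear_map K M N h \<longleftrightarrow>
    h \<in> carrier M \<rightarrow> carrier N \<and>
    (\<forall>x\<in>carrier M. \<forall>y\<in>carrier M. h (x \<oplus>\<^bsub>M\<^esub> y) = h x \<oplus>\<^bsub>N\<^esub> h y) \<and>
    (\<forall>c\<in>carrier K. \<forall>x\<in>carrier M. h (c \<odot>\<^bsub>M\<^esub> x) = c \<odot>\<^bsub>N\<^esub> h x)"

lemma linear_mapI:
  assumes "\<And>x. x \<in> carrier M \<Longrightarrow> h x \<in> carrier N"
    and "\<And>x y. x \<in> carrier M \<Longrightarrow> y \<in> carrier M \<Longrightarrow> h (x \<oplus>\<^bsub>M\<^esub> y) = h x \<oplus>\<^bsub>N\<^esub> h y"
    and "\<And>c x. c \<in> carrier K \<Longrightarrow> x \<in> carrier M \<Longrightarrow> h (c \<odot>\<^bsub>M\<^esub> x) = c \<odot>\<^bsub>N\<^esub> h x"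
  shows "linear_map K M N h"
  using assms by (auto simp: linear_map_def)

lemma linear_map_closed: "linear_map K M N h \<Longrightarrow> x \<in> carrier M \<Longrightarrow> h x \<in> carrier N"
  and linear_map_add: "linear_map K M N h \<Longrightarrow> x \<in> carrier M \<Longrightarrow> y \<in> carrier M \<Longrightarrow>
    h (x \<oplus>\<^bsub>M\<^esub> y) = h x \<oplus>\<^bsub>N\<^esub> h y"
  and linear_map_smult: "linear_map K M N h \<Longrightarrow> c \<in> carrier K \<Longrightarrow> x \<in> carrier M \<Longrightarrow>
    h (c \<odot>\<^bsub>M\<^esub> x) = c \<odot>\<^bsub>N\<^esub> h x"
  by (auto simp: linear_map_def)

lemma linear_map_zero:
  assumes "module K M" "module K N" "linear_map K M N h"
  shows "h \<zero>\<^bsub>M\<^esub> = \<zero>\<^bsub>N\<^esub>"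
proof -
  interpret M: module K M by fact
  interpret N: module K N by fact
  have "h (\<zero>\<^bsub>K\<^esub> \<odot>\<^bsub>M\<^esub> \<zero>\<^bsub>M\<^esub>) = \<zero>\<^bsub>K\<^esub> \<odot>\<^bsub>N\<^esub> h \<zero>\<^bsub>M\<^esub>"
    by (rule linear_map_smult[OF assms(3)]) auto
  then show ?thesis
    using linear_map_closed[OF assms(3) M.zero_closed] by simp
qed

lemma linear_map_comp:
  assumes "linear_map K M N g" "linear_map K N L h"
  shows "linear_map K M L (\<lambda>x. h (g x))"
  using assms by (auto simp: linear_map_def Pi_iff)

lemma linear_map_cong:
  assumes "module K M" "\<And>x. x \<in> carrier M \<Longrightarrow> g x = h x"
  shows "linear_map K M N g \<longleftrightarrow> linear_map K M N h"
proof -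
  interpret module K M by fact
  show ?thesis using assms(2) by (auto simp: linear_map_def Pi_iff)
qed

lemma linear_map_pointwise_add:
  assumes N: "module K N" and g: "linear_map K M N g" and h: "linear_map K M N h"
  shows "linear_map K M N (\<lambda>x. g x \<oplus>\<^bsub>N\<^esub> h x)"
proof -
  interpret N: module K N by fact
  show ?thesis
    using linear_map_closed[OF g] linear_map_closed[OF h]
    by (intro linear_mapI)
       (auto simp: linear_map_add[OF g] linear_map_add[OF h] linear_map_smult[OF g]
          linear_map_smult[OF h] N.smult_r_distr N.add.m_ac)
qed

lemma linear_map_scale:
  assumes N: "module K N" and c: "c \<in> carrier K"
  shows "linear_map K N N (\<lambda>x. c \<odot>\<^bsub>N\<^esub> x)"
proof -
  interpret N: module K N by fact
  show ?thesis using c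
    by (intro linear_mapI)
       (auto simp: N.smult_r_distr N.smult_assoc1[symmetric] N.R.m_comm)
qed

text \<open>
  Additive inverses are multiples by \<open>-1\<close>, so neither the inverses of a module nor the closure of
  a submodule under them has to be checked separately.
\<close>

lemma module_by_smult:
  assumes K: "cring K"
    and zero: "\<zero>\<^bsub>M\<^esub> \<in> carrier M"
    and add: "\<And>x y. x \<in> carrier M \<Longrightarrow> y \<in> carrier M \<Longrightarrow> x \<oplus>\<^bsub>M\<^esub> y \<in> carrier M"
    and smult: "\<And>c x. c \<in> carrier K \<Longrightarrow> x \<in> carrier M \<Longrightarrow> c \<odot>\<^bsub>M\<^esub> x \<in> carrier M"
    and assoc: "\<And>x y z. x \<in> carrier M \<Longrightarrow> y \<in> carrier M \<Longrightarrow> z \<in> carrier M \<Longrightarrow>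
      (x \<oplus>\<^bsub>M\<^esub> y) \<oplus>\<^bsub>M\<^esub> z = x \<oplus>\<^bsub>M\<^esub> (y \<oplus>\<^bsub>M\<^esub> z)"
    and comm: "\<And>x y. x \<in> carrier M \<Longrightarrow> y \<in> carrier M \<Longrightarrow> x \<oplus>\<^bsub>M\<^esub> y = y \<oplus>\<^bsub>M\<^esub> x"
    and l_zero: "\<And>x. x \<in> carrier M \<Longrightarrow> \<zero>\<^bsub>M\<^esub> \<oplus>\<^bsub>M\<^esub> x = x"
    and smult_null: "\<And>x. x \<in> carrier M \<Longrightarrow> \<zero>\<^bsub>K\<^esub> \<odot>\<^bsub>M\<^esub> x = \<zero>\<^bsub>M\<^esub>"
    and l_distr: "\<And>a b x. a \<in> carrier K \<Longrightarrow> b \<in> carrier K \<Longrightarrow> x \<in> carrier M \<Longrightarrow>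
      (a \<oplus>\<^bsub>K\<^esub> b) \<odot>\<^bsub>M\<^esub> x = a \<odot>\<^bsub>M\<^esub> x \<oplus>\<^bsub>M\<^esub> b \<odot>\<^bsub>M\<^esub> x"
    and r_distr: "\<And>a x y. a \<in> carrier K \<Longrightarrow> x \<in> carrier M \<Longrightarrow> y \<in> carrier M \<Longrightarrow>
      a \<odot>\<^bsub>M\<^esub> (x \<oplus>\<^bsub>M\<^esub> y) = a \<odot>\<^bsub>M\<^esub> x \<oplus>\<^bsub>M\<^esub> a \<odot>\<^bsub>M\<^esub> y"
    and smult_assoc: "\<And>a b x. a \<in> carrier K \<Longrightarrow> b \<in> carrier K \<Longrightarrow> x \<in> carrier M \<Longrightarrow>
      (a \<otimes>\<^bsub>K\<^esub> b) \<odot>\<^bsub>M\<^esub> x = a \<odot>\<^bsub>M\<^esub> (b \<odot>\<^bsub>M\<^esub> x)"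
    and one: "\<And>x. x \<in> carrier M \<Longrightarrow> \<one>\<^bsub>K\<^esub> \<odot>\<^bsub>M\<^esub> x = x"
  shows "module K M"
proof (rule moduleI[OF K])
  interpret K: cring K by fact
  show "abelian_group M"
  proof (rule abelian_groupI)
    fix x assume x: "x \<in> carrier M"
    have "(\<ominus>\<^bsub>K\<^esub> \<one>\<^bsub>K\<^esub>) \<odot>\<^bsub>M\<^esub> x \<oplus>\<^bsub>M\<^esub> x = (\<ominus>\<^bsub>K\<^esub> \<one>\<^bsub>K\<^esub> \<oplus>\<^bsub>K\<^esub> \<one>\<^bsub>K\<^esub>) \<odot>\<^bsub>M\<^esub> x"
      using x by (simp add: l_distr one)
    also have "\<dots> = \<zero>\<^bsub>M\<^esub>"
      using x by (simp add: K.l_neg smult_null)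
    finally show "\<exists>y\<in>carrier M. y \<oplus>\<^bsub>M\<^esub> x = \<zero>\<^bsub>M\<^esub>"
      using x smult by blast
  qed (use assms in auto)
qed (use assms in auto)

lemma submodule_by_smult:
  assumes M: "module K M" and "H \<subseteq> carrier M" "\<zero>\<^bsub>M\<^esub> \<in> H"
    and "\<And>x y. x \<in> H \<Longrightarrow> y \<in> H \<Longrightarrow> x \<oplus>\<^bsub>M\<^esub> y \<in> H"
    and smult: "\<And>c x. c \<in> carrier K \<Longrightarrow> x \<in> H \<Longrightarrow> c \<odot>\<^bsub>M\<^esub> x \<in> H"
  shows "submodule H K M"
proof -
  interpret M: module K M by fact
  show ?thesis
  proof (rule M.submoduleI)
    fix x assume x: "x \<in> H"
    have "(\<ominus>\<^bsub>K\<^esub> \<one>\<^bsub>K\<^esub>) \<odot>\<^bsub>M\<^esub> x = \<ominus>\<^bsub>M\<^esub> x"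
      using x assms(2) by (auto simp: M.smult_l_minus)
    then show "\<ominus>\<^bsub>M\<^esub> x \<in> H"
      using smult[OF _ x, of "\<ominus>\<^bsub>K\<^esub> \<one>\<^bsub>K\<^esub>"] by simp
  qed (use assms in auto)
qed

lemma submodule_subset: "submodule H K M \<Longrightarrow> H \<subseteq> carrier M"
  and submodule_zero: "submodule H K M \<Longrightarrow> \<zero>\<^bsub>M\<^esub> \<in> H"
  and submodule_add: "submodule H K M \<Longrightarrow> x \<in> H \<Longrightarrow> y \<in> H \<Longrightarrow> x \<oplus>\<^bsub>M\<^esub> y \<in> H"
  and submodule_smult: "submodule H K M \<Longrightarrow> c \<in> carrier K \<Longrightarrow> x \<in> H \<Longrightarrow> c \<odot>\<^bsub>M\<^esub> x \<in> H"
  using subgroup.subset[of H "add_monoid M"] subgroup.one_closed[of H "add_monoid M"]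
    subgroup.m_closed[of H "add_monoid M"]
  by (auto simp: submodule_def submodule_axioms_def)

text \<open>
  Together with the spanning lemmas below, the next two lemmas reduce an identity between linear
  maps, or membership of a linear image in a submodule, to a spanning set.
\<close>

lemma equalizer_submodule:
  assumes M: "module K M" and N: "module K N" and g: "linear_map K M N g" and h: "linear_map K M N h"
  shows "submodule {x \<in> carrier M. g x = h x} K M"
proof -
  interpret M: module K M by fact
  show ?thesis
    using linear_map_zero[OF M N g] linear_map_zero[OF M N h]
    by (intro submodule_by_smult[OF M])
       (auto simp: linear_map_add[OF g] linear_map_add[OF h] linear_map_smult[OF g]
          linear_map_smult[OF h])
qed

lemma vimage_submodule:
  assumes M: "module K M" and N: "module K N" and g: "linear_map K M N g" and H: "submodule H K N"
  shows "submodule {x \<in> carrier M. g x \<in> H} K M"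
proof -
  interpret M: module K M by fact
  show ?thesis
    using linear_map_zero[OF M N g] submodule_zero[OF H]
    by (intro submodule_by_smult[OF M])
       (auto simp: linear_map_add[OF g] linear_map_smult[OF g] submodule_add[OF H]
          submodule_smult[OF H])
qed

lemma generated_submodule_submodule:
  assumes M: "module K M" and A: "A \<subseteq> carrier M"
  shows "submodule (generated_submodule K M A) K M"
proof -
  interpret M: module K M by fact
  show ?thesis
    unfolding generated_submodule_def
  proof (rule submodule_by_smult[OF M])
    show "\<Inter> {H. submodule H K M \<and> A \<subseteq> H} \<subseteq> carrier M"
      using M.carrier_is_submodule A by blast
  qed (auto intro: submodule_zero submodule_add submodule_smult)
qed

lemma generated_submodule_incl: "A \<subseteq> generated_submodule K M A"
  by (auto simp: generated_submodule_def)

lemma generated_submodule_least: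
  "submodule H K M \<Longrightarrow> A \<subseteq> H \<Longrightarrow> generated_submodule K M A \<subseteq> H"
  by (auto simp: generated_submodule_def)

text \<open>
  The module axioms are equations between operations, with negation given by \<open>-1\<close>, so they pass
  from a module to any structure onto which it maps compatibly with the operations. Quotients and
  copies are modules for this reason.
\<close>

lemma module_of_image:
  assumes M: "module K M" and q: "linear_map K M N q" and onto: "q ` carrier M = carrier N"
    and zero: "q \<zero>\<^bsub>M\<^esub> = \<zero>\<^bsub>N\<^esub>"
  shows "module K N"
proof -
  interpret M: module K M by fact
  note q_simps = linear_map_add[OF q, symmetric] linear_map_smult[OF q, symmetric] zero[symmetric]
  show ?thesis
    by (rule module_by_smult)
       (auto simp: onto[symmetric] q_simps M.is_cring M.add.m_ac M.smult_l_distr M.smult_r_distr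
          M.smult_assoc1)
qed


section \<open>Quotients and copies\<close>

text \<open>
  The scalar action on cosets is a union over all representatives; its members coincide because the
  submodule is closed under scalars.
\<close>

lemma
  assumes M: "module K M" and S: "submodule S K M"
  shows quotient_module_module: "module K (quotient_module M S)"
    and coset_map_linear: "linear_map K M (quotient_module M S) (\<lambda>x. S +>\<^bsub>M\<^esub> x)"
    and coset_map_onto: "(\<lambda>x. S +>\<^bsub>M\<^esub> x) ` carrier M = carrier (quotient_module M S)"
proof -
  interpret M: module K M by fact
  have sg: "subgroup S (add_monoid M)" using S by (simp add: submodule_def)
  interpret S: abelian_subgroup S M
    by (rule abelian_subgroupI3) (auto simp: additive_subgroup_def sg M.abelian_group_axioms)
  show onto: "(\<lambda>x. S +>\<^bsub>M\<^esub> x) ` carrier M = carrier (quotient_module M S)"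
    by (auto simp: quotient_module_def A_RCOSETS_def')
  show lin: "linear_map K M (quotient_module M S) (\<lambda>x. S +>\<^bsub>M\<^esub> x)"
  proof (rule linear_mapI)
    fix c x assume c: "c \<in> carrier K" and x: "x \<in> carrier M"
    have eq: "S +>\<^bsub>M\<^esub> (c \<odot>\<^bsub>M\<^esub> z) = S +>\<^bsub>M\<^esub> (c \<odot>\<^bsub>M\<^esub> x)" if z: "z \<in> S +>\<^bsub>M\<^esub> x" for z
    proof -
      obtain s where s: "s \<in> S" "z = s \<oplus>\<^bsub>M\<^esub> x"
        using z by (auto simp: a_r_coset_def')
      have "c \<odot>\<^bsub>M\<^esub> z = c \<odot>\<^bsub>M\<^esub> s \<oplus>\<^bsub>M\<^esub> c \<odot>\<^bsub>M\<^esub> x"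
        using s c x S.a_subset by (auto simp: M.smult_r_distr)
      moreover have "c \<odot>\<^bsub>M\<^esub> s \<in> S" using submodule_smult[OF S c] s by blast
      ultimately have "c \<odot>\<^bsub>M\<^esub> z \<in> S +>\<^bsub>M\<^esub> (c \<odot>\<^bsub>M\<^esub> x)"
        by (auto simp: a_r_coset_def')
      then show ?thesis
        using M.a_repr_independence[OF _ _ sg] c x by auto
    qed
    have "x \<in> S +>\<^bsub>M\<^esub> x" using S.a_rcos_self x by blast
    then have "(\<Union>z\<in>S +>\<^bsub>M\<^esub> x. S +>\<^bsub>M\<^esub> (c \<odot>\<^bsub>M\<^esub> z)) = S +>\<^bsub>M\<^esub> (c \<odot>\<^bsub>M\<^esub> x)"
      by (intro SUP_eq_const eq) auto
    then show "S +>\<^bsub>M\<^esub> (c \<odot>\<^bsub>M\<^esub> x) = c \<odot>\<^bsub>quotient_module M S\<^esub> (S +>\<^bsub>M\<^esub> x)"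
      by (simp add: quotient_module_def)
  qed (use onto S.a_rcos_sum in \<open>auto simp: quotient_module_def\<close>)
  show "module K (quotient_module M S)"
    by (rule module_of_image[OF M lin onto])
       (use S.a_subset in \<open>simp add: quotient_module_def\<close>)
qed

lemma module_copy_module:
  assumes A: "module K A" and h: "inj h"
  shows "module K (module_copy h A)"
proof -
  interpret A: module K A by fact
  have lin: "linear_map K A (module_copy h A) h"
    by (rule linear_mapI) (auto simp: module_copy_def h)
  show ?thesis
    by (rule module_of_image[OF A lin]) (auto simp: module_copy_def)
qed

lemma linear_map_from_copy:
  assumes A: "module K A" and h: "inj h"
  shows "linear_map K (module_copy h A) N F \<longleftrightarrow> linear_map K A N (\<lambda>x. F (h x))"
proof -
  interpret A: module K A by fact
  show ?thesis
    using h by (auto simp: linear_map_def module_copy_def)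
qed

lemma carrier_module_copy: "carrier (module_copy h A) = h ` carrier A"
  by (simp add: module_copy_def)


section \<open>Direct sums and free modules\<close>

definition single :: "'i set \<Rightarrow> ('i \<Rightarrow> ('k, 'm) module) \<Rightarrow> 'i \<Rightarrow> 'm \<Rightarrow> 'i \<Rightarrow> 'm" where
  "single I M i x = (\<lambda>j\<in>I. if j = i then x else \<zero>\<^bsub>M j\<^esub>)"

definition sum_lift ::
    "'i set \<Rightarrow> ('i \<Rightarrow> ('k, 'm) module) \<Rightarrow> ('k, 'n, 'e) module_scheme \<Rightarrow> ('i \<Rightarrow> 'm \<Rightarrow> 'n) \<Rightarrow> ('i \<Rightarrow> 'm) \<Rightarrow> 'n" where
  "sum_lift I M N h f = (\<Oplus>\<^bsub>N\<^esub>i\<in>{i \<in> I. f i \<noteq> \<zero>\<^bsub>M i\<^esub>}. h i (f i))"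

lemma direct_sum_carrier:
  "f \<in> carrier (direct_sum I M) \<longleftrightarrow>
    f \<in> (\<Pi>\<^sub>E i\<in>I. carrier (M i)) \<and> finite {i \<in> I. f i \<noteq> \<zero>\<^bsub>M i\<^esub>}"
  by (simp add: direct_sum_def)

lemma direct_sum_component: "f \<in> carrier (direct_sum I M) \<Longrightarrow> i \<in> I \<Longrightarrow> f i \<in> carrier (M i)"
  by (auto simp: direct_sum_carrier)

lemma direct_sum_eqI:
  "f \<in> carrier (direct_sum I M) \<Longrightarrow> g \<in> carrier (direct_sum I M) \<Longrightarrow> (\<And>i. i \<in> I \<Longrightarrow> f i = g i) \<Longrightarrow> f = g"
  using PiE_ext[of f I "\<lambda>i. carrier (M i)" g] by (simp add: direct_sum_carrier)

lemma direct_sum_ops: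
  "\<zero>\<^bsub>direct_sum I M\<^esub> = (\<lambda>i\<in>I. \<zero>\<^bsub>M i\<^esub>)"
  "f \<oplus>\<^bsub>direct_sum I M\<^esub> g = (\<lambda>i\<in>I. f i \<oplus>\<^bsub>M i\<^esub> g i)"
  "c \<odot>\<^bsub>direct_sum I M\<^esub> f = (\<lambda>i\<in>I. c \<odot>\<^bsub>M i\<^esub> f i)"
  by (simp_all add: direct_sum_def)

lemma direct_sum_module:
  assumes K: "cring K" and M: "\<And>i. i \<in> I \<Longrightarrow> module K (M i)"
  shows "module K (direct_sum I M)"
proof (rule module_by_smult[OF K])
  have ag: "abelian_group (M i)" if "i \<in> I" for i using M[OF that] by (simp add: module_def)
  note ax = abelian_group.axioms(1)[OF ag]
  note comp = direct_sum_component
  show "\<zero>\<^bsub>direct_sum I M\<^esub> \<in> carrier (direct_sum I M)"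
    by (auto simp: direct_sum_carrier direct_sum_ops abelian_monoid.zero_closed[OF ax])
  show add: "f \<oplus>\<^bsub>direct_sum I M\<^esub> g \<in> carrier (direct_sum I M)"
    if f: "f \<in> carrier (direct_sum I M)" and g: "g \<in> carrier (direct_sum I M)" for f g
  proof -
    have "{i \<in> I. f i \<oplus>\<^bsub>M i\<^esub> g i \<noteq> \<zero>\<^bsub>M i\<^esub>} \<subseteq> {i \<in> I. f i \<noteq> \<zero>\<^bsub>M i\<^esub>} \<union> {i \<in> I. g i \<noteq> \<zero>\<^bsub>M i\<^esub>}"
      using abelian_monoid.l_zero[OF ax] abelian_monoid.zero_closed[OF ax] by auto
    then have "finite {i \<in> I. f i \<oplus>\<^bsub>M i\<^esub> g i \<noteq> \<zero>\<^bsub>M i\<^esub>}"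
      using f g by (auto simp: direct_sum_carrier intro: finite_subset)
    then show ?thesis
      using comp[OF f] comp[OF g]
      by (auto simp: direct_sum_carrier direct_sum_ops abelian_monoid.a_closed[OF ax] cong: conj_cong)
  qed
  show smult: "c \<odot>\<^bsub>direct_sum I M\<^esub> f \<in> carrier (direct_sum I M)"
    if c: "c \<in> carrier K" and f: "f \<in> carrier (direct_sum I M)" for c f
  proof -
    have "{i \<in> I. c \<odot>\<^bsub>M i\<^esub> f i \<noteq> \<zero>\<^bsub>M i\<^esub>} \<subseteq> {i \<in> I. f i \<noteq> \<zero>\<^bsub>M i\<^esub>}"
      using module.smult_r_null[OF M] c by auto
    then have "finite {i \<in> I. c \<odot>\<^bsub>M i\<^esub> f i \<noteq> \<zero>\<^bsub>M i\<^esub>}"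
      using f by (auto simp: direct_sum_carrier intro: finite_subset)
    then show ?thesis
      using comp[OF f] c
      by (auto simp: direct_sum_carrier direct_sum_ops module.smult_closed[OF M] cong: conj_cong)
  qed
  note ops = direct_sum_ops restrict_apply
  show "f \<oplus>\<^bsub>direct_sum I M\<^esub> g \<oplus>\<^bsub>direct_sum I M\<^esub> k = f \<oplus>\<^bsub>direct_sum I M\<^esub> (g \<oplus>\<^bsub>direct_sum I M\<^esub> k)"
    if "f \<in> carrier (direct_sum I M)" "g \<in> carrier (direct_sum I M)" "k \<in> carrier (direct_sum I M)" for f g k
    using that by (intro direct_sum_eqI[where I = I and M = M]) (simp_all add: add, simp add: ops abelian_monoid.a_assoc[OF ax] comp)
  show "f \<oplus>\<^bsub>direct_sum I M\<^esub> g = g \<oplus>\<^bsub>direct_sum I M\<^esub> f"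
    if "f \<in> carrier (direct_sum I M)" "g \<in> carrier (direct_sum I M)" for f g
    using that by (intro direct_sum_eqI[where I = I and M = M]) (simp_all add: add, simp add: ops abelian_monoid.a_comm[OF ax] comp)
  show "\<zero>\<^bsub>direct_sum I M\<^esub> \<oplus>\<^bsub>direct_sum I M\<^esub> f = f" if "f \<in> carrier (direct_sum I M)" for f
    using that \<open>\<zero>\<^bsub>direct_sum I M\<^esub> \<in> carrier (direct_sum I M)\<close>
    by (intro direct_sum_eqI[where I = I and M = M]) (simp_all add: add, simp add: ops abelian_monoid.l_zero[OF ax] comp)
  show "\<zero>\<^bsub>K\<^esub> \<odot>\<^bsub>direct_sum I M\<^esub> f = \<zero>\<^bsub>direct_sum I M\<^esub>" if "f \<in> carrier (direct_sum I M)" for f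
    using that by (auto simp: ops module.smult_l_null[OF M] comp intro!: restrict_ext)
  show "(a \<oplus>\<^bsub>K\<^esub> b) \<odot>\<^bsub>direct_sum I M\<^esub> f = a \<odot>\<^bsub>direct_sum I M\<^esub> f \<oplus>\<^bsub>direct_sum I M\<^esub> b \<odot>\<^bsub>direct_sum I M\<^esub> f"
    if "a \<in> carrier K" "b \<in> carrier K" "f \<in> carrier (direct_sum I M)" for a b f
    using that by (auto simp: ops module.smult_l_distr[OF M] comp intro!: restrict_ext)
  show "a \<odot>\<^bsub>direct_sum I M\<^esub> (f \<oplus>\<^bsub>direct_sum I M\<^esub> g) = a \<odot>\<^bsub>direct_sum I M\<^esub> f \<oplus>\<^bsub>direct_sum I M\<^esub> a \<odot>\<^bsub>direct_sum I M\<^esub> g"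
    if "a \<in> carrier K" "f \<in> carrier (direct_sum I M)" "g \<in> carrier (direct_sum I M)" for a f g
    using that by (auto simp: ops module.smult_r_distr[OF M] comp intro!: restrict_ext)
  show "(a \<otimes>\<^bsub>K\<^esub> b) \<odot>\<^bsub>direct_sum I M\<^esub> f = a \<odot>\<^bsub>direct_sum I M\<^esub> (b \<odot>\<^bsub>direct_sum I M\<^esub> f)"
    if "a \<in> carrier K" "b \<in> carrier K" "f \<in> carrier (direct_sum I M)" for a b f
    using that by (auto simp: ops module.smult_assoc1[OF M] comp intro!: restrict_ext)
  show "\<one>\<^bsub>K\<^esub> \<odot>\<^bsub>direct_sum I M\<^esub> f = f" if "f \<in> carrier (direct_sum I M)" for f
    using that cring.axioms(1)[OF K]
    by (intro direct_sum_eqI[where I = I and M = M]) (simp_all add: smult ring.ring_simprules, simp add: ops module.smult_one[OF M] comp)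
qed

lemma single_linear:
  assumes M: "\<And>i. i \<in> I \<Longrightarrow> module K (M i)" and i: "i \<in> I"
  shows "linear_map K (M i) (direct_sum I M) (single I M i)"
proof -
  have ag: "abelian_group (M i)" if "i \<in> I" for i using M[OF that] by (simp add: module_def)
  note ax = abelian_group.axioms(1)[OF ag]
  show ?thesis
  proof (rule linear_mapI)
    fix x assume x: "x \<in> carrier (M i)"
    have "finite {j \<in> I. single I M i x j \<noteq> \<zero>\<^bsub>M j\<^esub>}"
      by (rule finite_subset[of _ "{i}"]) (auto simp: single_def)
    then show "single I M i x \<in> carrier (direct_sum I M)"
      using x by (auto simp: direct_sum_carrier single_def abelian_monoid.zero_closed[OF ax])
  next
    fix x y assume "x \<in> carrier (M i)" "y \<in> carrier (M i)"
    then show "single I M i (x \<oplus>\<^bsub>M i\<^esub> y) = single I M i x \<oplus>\<^bsub>direct_sum I M\<^esub> single I M i y"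
      by (auto simp: direct_sum_ops single_def abelian_monoid.zero_closed[OF ax]
          abelian_monoid.l_zero[OF ax] intro!: restrict_ext)
  next
    fix c x assume "c \<in> carrier K" "x \<in> carrier (M i)"
    then show "single I M i (c \<odot>\<^bsub>M i\<^esub> x) = c \<odot>\<^bsub>direct_sum I M\<^esub> single I M i x"
      by (auto simp: direct_sum_ops single_def module.smult_r_null[OF M] intro!: restrict_ext)
  qed
qed

text \<open>Induction on a finite set containing the support, splitting off one component at a time.\<close>

lemma direct_sum_spanned:
  assumes K: "cring K" and M: "\<And>i. i \<in> I \<Longrightarrow> module K (M i)"
    and H: "submodule H K (direct_sum I M)"
    and single: "\<And>i x. i \<in> I \<Longrightarrow> x \<in> carrier (M i) \<Longrightarrow> single I M i x \<in> H"
    and f: "f \<in> carrier (direct_sum I M)"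
  shows "f \<in> H"
proof -
  have ag: "abelian_group (M i)" if "i \<in> I" for i using M[OF that] by (simp add: module_def)
  note ax = abelian_group.axioms(1)[OF ag]
  have fin: "finite {i \<in> I. f i \<noteq> \<zero>\<^bsub>M i\<^esub>}" using f by (simp add: direct_sum_carrier)
  have "\<forall>f. f \<in> carrier (direct_sum I M) \<longrightarrow> {i \<in> I. f i \<noteq> \<zero>\<^bsub>M i\<^esub>} \<subseteq> A \<longrightarrow> f \<in> H" if "finite A" for A
    using that
  proof (induction A)
    case empty
    have "f \<in> H" if "f \<in> carrier (direct_sum I M)" "{i \<in> I. f i \<noteq> \<zero>\<^bsub>M i\<^esub>} \<subseteq> {}" for f
    proof -
      have "f = \<zero>\<^bsub>direct_sum I M\<^esub>"
        using that
        by (intro direct_sum_eqI[where I = I and M = M])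
           (auto simp: direct_sum_ops direct_sum_carrier abelian_monoid.zero_closed[OF ax])
      then show ?thesis using submodule_zero[OF H] by simp
    qed
    then show ?case by blast
  next
    case (insert i A)
    show ?case
    proof (intro allI impI)
      fix f assume f: "f \<in> carrier (direct_sum I M)" and sub: "{j \<in> I. f j \<noteq> \<zero>\<^bsub>M j\<^esub>} \<subseteq> insert i A"
      show "f \<in> H"
      proof (cases "i \<in> I")
        case False
        then have "{j \<in> I. f j \<noteq> \<zero>\<^bsub>M j\<^esub>} \<subseteq> A" using sub by auto
        then show ?thesis using insert.IH f by blast
      next
        case i: True
        define g where "g = (\<lambda>j\<in>I. if j = i then \<zero>\<^bsub>M j\<^esub> else f j)"
        have gA: "{j \<in> I. g j \<noteq> \<zero>\<^bsub>M j\<^esub>} \<subseteq> A" using sub by (auto simp: g_def)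
        have g: "g \<in> carrier (direct_sum I M)"
          using direct_sum_component[OF f] finite_subset[OF gA insert.hyps(1)]
          by (auto simp: direct_sum_carrier g_def abelian_monoid.zero_closed[OF ax])
        have fi: "single I M i (f i) \<in> H" by (rule single[OF i direct_sum_component[OF f i]])
        have "g \<oplus>\<^bsub>direct_sum I M\<^esub> single I M i (f i) = f"
        proof (rule direct_sum_eqI)
          show "g \<oplus>\<^bsub>direct_sum I M\<^esub> single I M i (f i) \<in> carrier (direct_sum I M)"
            using submodule_add[OF H _ fi] insert.IH g gA submodule_subset[OF H] by blast
        qed (use f direct_sum_component[OF f] in \<open>auto simp: direct_sum_ops g_def single_def
            abelian_monoid.l_zero[OF ax] abelian_monoid.r_zero[OF ax]\<close>)
        moreover have "g \<in> H" using insert.IH g gA by blast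
        ultimately show ?thesis
          using submodule_add[OF H _ fi, of g] by simp
      qed
    qed
  qed
  then show ?thesis using fin f by blast
qed

text \<open>
  The sum may be taken over any finite set containing the support; a common such set for two
  elements makes the lift additive.
\<close>

lemma sum_lift_superset:
  assumes M: "\<And>i. i \<in> I \<Longrightarrow> module K (M i)" and N: "module K N"
    and h: "\<And>i. i \<in> I \<Longrightarrow> linear_map K (M i) N (h i)"
    and f: "\<And>i. i \<in> I \<Longrightarrow> f i \<in> carrier (M i)"
    and A: "finite A" "{i \<in> I. f i \<noteq> \<zero>\<^bsub>M i\<^esub>} \<subseteq> A" "A \<subseteq> I"
  shows "sum_lift I M N h f = (\<Oplus>\<^bsub>N\<^esub>i\<in>A. h i (f i))"
proof -
  interpret N: module K N by fact
  show ?thesis unfolding sum_lift_def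
  proof (rule N.add.finprod_mono_neutral_cong_left[OF A(1,2)])
    show "h i (f i) = \<zero>\<^bsub>N\<^esub>" if "i \<in> A - {i \<in> I. f i \<noteq> \<zero>\<^bsub>M i\<^esub>}" for i
      using that A(3) linear_map_zero[OF M N h, of i] by auto
    show "(\<lambda>i. h i (f i)) \<in> A \<rightarrow> carrier N"
      using A(3) f linear_map_closed[OF h] by blast
  qed simp
qed

lemma sum_lift_linear:
  assumes K: "cring K" and M: "\<And>i. i \<in> I \<Longrightarrow> module K (M i)" and N: "module K N"
    and h: "\<And>i. i \<in> I \<Longrightarrow> linear_map K (M i) N (h i)"
  shows "linear_map K (direct_sum I M) N (sum_lift I M N h)"
proof -
  interpret N: module K N by fact
  interpret D: module K "direct_sum I M" by (rule direct_sum_module[OF K M])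
  note comp = direct_sum_component
  note sup = sum_lift_superset[OF M N h]
  have hc: "(\<lambda>i. h i (f i)) \<in> A \<rightarrow> carrier N" if "f \<in> carrier (direct_sum I M)" "A \<subseteq> I" for f A
    using that by (auto intro!: linear_map_closed[OF h] direct_sum_component[of f I M])
  define S where "S f = {i \<in> I. f i \<noteq> \<zero>\<^bsub>M i\<^esub>}" for f
  have SI: "S f \<subseteq> I" for f by (auto simp: S_def)
  have fin: "finite (S f)" if "f \<in> carrier (direct_sum I M)" for f
    using that by (simp add: S_def direct_sum_carrier)
  show ?thesis
  proof (rule linear_mapI)
    fix f assume f: "f \<in> carrier (direct_sum I M)"
    show "sum_lift I M N h f \<in> carrier N"
      unfolding sum_lift_def by (rule N.finsum_closed[OF hc[OF f]]) auto
  next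
    fix f g assume f: "f \<in> carrier (direct_sum I M)" and g: "g \<in> carrier (direct_sum I M)"
    let ?fg = "f \<oplus>\<^bsub>direct_sum I M\<^esub> g"
    have fg: "?fg \<in> carrier (direct_sum I M)" using f g by simp
    define A where "A = S f \<union> S g \<union> S ?fg"
    have A: "finite A" "A \<subseteq> I" using fin f g fg SI by (auto simp: A_def)
    have "sum_lift I M N h ?fg = (\<Oplus>\<^bsub>N\<^esub>i\<in>A. h i (?fg i))"
      by (rule sup) (use A comp[OF fg] in \<open>auto simp: A_def S_def\<close>)
    also have "\<dots> = (\<Oplus>\<^bsub>N\<^esub>i\<in>A. h i (f i) \<oplus>\<^bsub>N\<^esub> h i (g i))"
      by (rule N.finsum_cong')
         (use A hc[OF f A(2)] hc[OF g A(2)] in \<open>auto simp: direct_sum_ops linear_map_add[OF h] comp[OF f] comp[OF g] subset_iff Pi_iff\<close>)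
    also have "\<dots> = (\<Oplus>\<^bsub>N\<^esub>i\<in>A. h i (f i)) \<oplus>\<^bsub>N\<^esub> (\<Oplus>\<^bsub>N\<^esub>i\<in>A. h i (g i))"
      by (rule N.finsum_addf) (rule hc[OF f A(2)], rule hc[OF g A(2)])
    also have "(\<Oplus>\<^bsub>N\<^esub>i\<in>A. h i (f i)) = sum_lift I M N h f"
      by (rule sup[symmetric]) (use A comp[OF f] in \<open>auto simp: A_def S_def\<close>)
    also have "(\<Oplus>\<^bsub>N\<^esub>i\<in>A. h i (g i)) = sum_lift I M N h g"
      by (rule sup[symmetric]) (use A comp[OF g] in \<open>auto simp: A_def S_def\<close>)
    finally show "sum_lift I M N h ?fg = sum_lift I M N h f \<oplus>\<^bsub>N\<^esub> sum_lift I M N h g" .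
  next
    fix c f assume c: "c \<in> carrier K" and f: "f \<in> carrier (direct_sum I M)"
    let ?cf = "c \<odot>\<^bsub>direct_sum I M\<^esub> f"
    have cf: "?cf \<in> carrier (direct_sum I M)" using c f by simp
    define A where "A = S f \<union> S ?cf"
    have A: "finite A" "A \<subseteq> I" using fin f cf SI by (auto simp: A_def)
    have "sum_lift I M N h ?cf = (\<Oplus>\<^bsub>N\<^esub>i\<in>A. h i (?cf i))"
      by (rule sup) (use A comp[OF cf] in \<open>auto simp: A_def S_def\<close>)
    also have "\<dots> = (\<Oplus>\<^bsub>N\<^esub>i\<in>A. c \<odot>\<^bsub>N\<^esub> h i (f i))"
      by (rule N.finsum_cong')
         (use A c hc[OF f A(2)] in \<open>auto simp: direct_sum_ops linear_map_smult[OF h] comp[OF f] subset_iff Pi_iff\<close>)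
    also have "\<dots> = c \<odot>\<^bsub>N\<^esub> (\<Oplus>\<^bsub>N\<^esub>i\<in>A. h i (f i))"
      by (rule N.finsum_smult_ldistr[symmetric]) (use A c hc[OF f A(2)] in auto)
    also have "(\<Oplus>\<^bsub>N\<^esub>i\<in>A. h i (f i)) = sum_lift I M N h f"
      by (rule sup[symmetric]) (use A comp[OF f] in \<open>auto simp: A_def S_def\<close>)
    finally show "sum_lift I M N h ?cf = c \<odot>\<^bsub>N\<^esub> sum_lift I M N h f" .
  qed
qed

lemma sum_lift_single:
  assumes M: "\<And>i. i \<in> I \<Longrightarrow> module K (M i)" and N: "module K N"
    and h: "\<And>i. i \<in> I \<Longrightarrow> linear_map K (M i) N (h i)"
    and i: "i \<in> I" and x: "x \<in> carrier (M i)"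
  shows "sum_lift I M N h (single I M i x) = h i x"
proof -
  interpret N: module K N by fact
  have ag: "abelian_group (M i)" if "i \<in> I" for i using M[OF that] by (simp add: module_def)
  note ax = abelian_group.axioms(1)[OF ag]
  have "sum_lift I M N h (single I M i x) = (\<Oplus>\<^bsub>N\<^esub>j\<in>{i}. h j (single I M i x j))"
    by (rule sum_lift_superset[OF M N h])
       (use i x in \<open>auto simp: single_def abelian_monoid.zero_closed[OF ax]\<close>)
  also have "\<dots> = h i x"
    using linear_map_closed[OF h[OF i] x] i by (simp add: single_def)
  finally show ?thesis .
qed

lemma direct_sum_map_linear:
  assumes K: "cring K" and M: "\<And>i. i \<in> I \<Longrightarrow> module K (M i)" and N: "\<And>i. i \<in> I \<Longrightarrow> module K (N i)"
    and g: "\<And>i. i \<in> I \<Longrightarrow> linear_map K (M i) (N i) (g i)"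
  shows "linear_map K (direct_sum I M) (direct_sum I N) (\<lambda>f. \<lambda>i\<in>I. g i (f i))"
proof (rule linear_mapI)
  fix f assume f: "f \<in> carrier (direct_sum I M)"
  have "{i \<in> I. g i (f i) \<noteq> \<zero>\<^bsub>N i\<^esub>} \<subseteq> {i \<in> I. f i \<noteq> \<zero>\<^bsub>M i\<^esub>}"
    using linear_map_zero[OF M N g] by auto
  then have "finite {i \<in> I. g i (f i) \<noteq> \<zero>\<^bsub>N i\<^esub>}"
    using f by (auto simp: direct_sum_carrier intro: finite_subset)
  then show "(\<lambda>i\<in>I. g i (f i)) \<in> carrier (direct_sum I N)"
    using linear_map_closed[OF g direct_sum_component[OF f]]
    by (auto simp: direct_sum_carrier cong: conj_cong)
qed (auto simp: direct_sum_ops linear_map_add[OF g] linear_map_smult[OF g] direct_sum_component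
    intro!: restrict_ext)

lemma regular_module_module:
  assumes K: "cring K"
  shows "module K (regular_module K)"
proof -
  interpret K: cring K by fact
  show ?thesis
    by (rule module_by_smult[OF K])
       (auto simp: regular_module_def K.a_assoc K.m_assoc K.l_distr K.r_distr intro: K.a_comm)
qed

lemma free_module_module: "cring K \<Longrightarrow> module K (free_module K Y)"
  unfolding free_module_def by (intro direct_sum_module regular_module_module)

lemma basis_elem_single: "basis_elem K Y y = single Y (\<lambda>_. regular_module K) y \<one>\<^bsub>K\<^esub>"
  by (auto simp: basis_elem_def single_def regular_module_def intro!: restrict_ext)

lemma basis_elem_smult:
  assumes K: "cring K" and c: "c \<in> carrier K"
  shows "c \<odot>\<^bsub>free_module K Y\<^esub> basis_elem K Y y = single Y (\<lambda>_. regular_module K) y c"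
proof -
  interpret K: cring K by fact
  show ?thesis
    using c by (auto simp: free_module_def direct_sum_ops basis_elem_def single_def regular_module_def
        intro!: restrict_ext)
qed

lemma basis_elem_closed:
  assumes K: "cring K" and y: "y \<in> Y"
  shows "basis_elem K Y y \<in> carrier (free_module K Y)"
proof -
  interpret K: cring K by fact
  show ?thesis
    unfolding basis_elem_single free_module_def
    by (rule linear_map_closed[OF single_linear[OF regular_module_module[OF K] y]])
       (simp add: regular_module_def)
qed

lemma free_module_spanned:
  assumes K: "cring K" and H: "submodule H K (free_module K Y)"
    and basis: "\<And>y. y \<in> Y \<Longrightarrow> basis_elem K Y y \<in> H"
    and f: "f \<in> carrier (free_module K Y)"
  shows "f \<in> H"
proof (rule direct_sum_spanned[OF K regular_module_module[OF K]])
  show "single Y (\<lambda>_. regular_module K) y c \<in> H"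
    if "y \<in> Y" "c \<in> carrier (regular_module K)" for y c
    using that submodule_smult[OF H _ basis[of y], of c] basis_elem_smult[OF K, of c Y y]
    by (simp add: regular_module_def)
qed (use H f in \<open>auto simp: free_module_def\<close>)

definition free_lift ::
    "('k, 'c) ring_scheme \<Rightarrow> 'y set \<Rightarrow> ('k, 'n, 'e) module_scheme \<Rightarrow> ('y \<Rightarrow> 'n) \<Rightarrow> ('y \<Rightarrow> 'k) \<Rightarrow> 'n" where
  "free_lift K Y N F f = (\<Oplus>\<^bsub>N\<^esub>y\<in>{y \<in> Y. f y \<noteq> \<zero>\<^bsub>K\<^esub>}. f y \<odot>\<^bsub>N\<^esub> F y)"

lemma
  assumes N: "module K N" and F: "\<And>y. y \<in> Y \<Longrightarrow> F y \<in> carrier N"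
  shows free_lift_linear: "linear_map K (free_module K Y) N (free_lift K Y N F)"
    and free_lift_basis: "y \<in> Y \<Longrightarrow> free_lift K Y N F (basis_elem K Y y) = F y"
proof -
  interpret N: module K N by fact
  have K: "cring K" by (rule N.is_cring)
  have eq: "free_lift K Y N F = sum_lift Y (\<lambda>_. regular_module K) N (\<lambda>y c. c \<odot>\<^bsub>N\<^esub> F y)"
    by (simp add: fun_eq_iff free_lift_def sum_lift_def regular_module_def)
  have lin: "linear_map K (regular_module K) N (\<lambda>c. c \<odot>\<^bsub>N\<^esub> F y)" if "y \<in> Y" for y
    using F[OF that] by (intro linear_mapI) (auto simp: regular_module_def N.smult_l_distr N.smult_assoc1)
  show "linear_map K (free_module K Y) N (free_lift K Y N F)"
    unfolding eq free_module_def
    by (rule sum_lift_linear[OF K regular_module_module[OF K] N lin])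
  show "free_lift K Y N F (basis_elem K Y y) = F y" if "y \<in> Y"
    unfolding eq basis_elem_single
    by (subst sum_lift_single[OF regular_module_module[OF K] N lin])
       (use that F in \<open>auto simp: regular_module_def\<close>)
qed


section \<open>Tensor products\<close>

text \<open>
  The relations that define the tensor product are differences. The next two lemmas relate them to
  equations: a linear map that satisfies the equation kills the difference, and cosets of a submodule
  that contains the difference satisfy the equation.
\<close>

lemma linear_map_diff_eq_zero:
  assumes M: "module K M" and N: "module K N" and h: "linear_map K M N h"
    and x: "x \<in> carrier M" and y: "y \<in> carrier M" and eq: "h x = h y"
  shows "h (x \<ominus>\<^bsub>M\<^esub> y) = \<zero>\<^bsub>N\<^esub>"
proof -
  interpret M: module K M by fact
  interpret N: module K N by fact
  have "x \<ominus>\<^bsub>M\<^esub> y = x \<oplus>\<^bsub>M\<^esub> (\<ominus>\<^bsub>K\<^esub> \<one>\<^bsub>K\<^esub>) \<odot>\<^bsub>M\<^esub> y"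
    using y by (simp add: a_minus_def M.smult_l_minus)
  then have "h (x \<ominus>\<^bsub>M\<^esub> y) = h y \<oplus>\<^bsub>N\<^esub> (\<ominus>\<^bsub>K\<^esub> \<one>\<^bsub>K\<^esub>) \<odot>\<^bsub>N\<^esub> h y"
    using x y eq by (simp add: linear_map_add[OF h] linear_map_smult[OF h])
  also have "\<dots> = \<zero>\<^bsub>N\<^esub>"
    using linear_map_closed[OF h y] by (simp add: N.smult_l_minus N.M.r_neg)
  finally show ?thesis .
qed

lemma coset_eqI:
  assumes M: "module K M" and S: "submodule S K M"
    and x: "x \<in> carrier M" and y: "y \<in> carrier M" and mem: "x \<ominus>\<^bsub>M\<^esub> y \<in> S"
  shows "S +>\<^bsub>M\<^esub> x = S +>\<^bsub>M\<^esub> y"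
proof -
  interpret M: module K M by fact
  have sg: "subgroup S (add_monoid M)" using S by (simp add: submodule_def)
  have "x = (x \<ominus>\<^bsub>M\<^esub> y) \<oplus>\<^bsub>M\<^esub> y"
    using x y by (simp add: a_minus_def M.M.a_assoc M.M.l_neg)
  then have "x \<in> S +>\<^bsub>M\<^esub> y"
    using mem by (auto simp: a_r_coset_def')
  then show ?thesis
    using M.a_repr_independence[OF _ y sg] by simp
qed

lemma linear_map_const_zero:
  assumes N: "module K N"
  shows "linear_map K M N (\<lambda>_. \<zero>\<^bsub>N\<^esub>)"
proof -
  interpret N: module K N by fact
  show ?thesis by (rule linear_mapI) auto
qed

lemma tensor_tuples_simps:
  "t \<in> tensor_tuples [] \<longleftrightarrow> t = []"
  "t \<in> tensor_tuples (M # Ms) \<longleftrightarrow> (\<exists>x xs. t = x # xs \<and> x \<in> carrier M \<and> xs \<in> tensor_tuples Ms)"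
  by (auto simp: tensor_tuples_def set_Cons_def)

lemma tensor_tuples_update:
  "t \<in> tensor_tuples Ms \<Longrightarrow> i < length Ms \<Longrightarrow> a \<in> carrier (Ms ! i) \<Longrightarrow> t[i := a] \<in> tensor_tuples Ms"
proof (induction Ms arbitrary: t i)
  case (Cons M Ms)
  then show ?case by (cases i) (auto simp: tensor_tuples_simps)
qed simp

definition multilinear ::
    "('k, 'c) ring_scheme \<Rightarrow> ('k, 'm) module list \<Rightarrow> ('k, 'n, 'e) module_scheme \<Rightarrow> ('m list \<Rightarrow> 'n) \<Rightarrow> bool" where
  "multilinear K Ms N F \<longleftrightarrow>
    (\<forall>t\<in>tensor_tuples Ms. F t \<in> carrier N \<and>
      (\<forall>i<length Ms. linear_map K (Ms ! i) N (\<lambda>a. F (t[i := a]))))"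

lemma multilinear_closed: "multilinear K Ms N F \<Longrightarrow> t \<in> tensor_tuples Ms \<Longrightarrow> F t \<in> carrier N"
  by (simp add: multilinear_def)

lemma multilinear_slot:
  "multilinear K Ms N F \<Longrightarrow> t \<in> tensor_tuples Ms \<Longrightarrow> i < length Ms \<Longrightarrow>
    linear_map K (Ms ! i) N (\<lambda>a. F (t[i := a]))"
  by (simp add: multilinear_def)

lemma multilinear_Nil: "multilinear K [] N F \<longleftrightarrow> F [] \<in> carrier N"
  by (simp add: multilinear_def tensor_tuples_def)

text \<open>
  Fixing the first entry leaves a multilinear map in the others. This form lets multilinearity be
  proved by recursion on the list of factors, which is how the factors of \<open>M\<^sub>R(X)\<close> are built.
\<close>

lemma multilinear_Cons:
  assumes "module K M"
  shows "multilinear K (M # Ms) N F \<longleftrightarrow>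
    (\<forall>x\<in>carrier M. multilinear K Ms N (\<lambda>xs. F (x # xs))) \<and>
    (\<forall>xs\<in>tensor_tuples Ms. linear_map K M N (\<lambda>x. F (x # xs)))"
    (is "?L \<longleftrightarrow> ?R")
proof
  interpret M: module K M by fact
  assume L: ?L
  have "multilinear K Ms N (\<lambda>xs. F (x # xs))" if x: "x \<in> carrier M" for x
    unfolding multilinear_def
  proof (intro ballI conjI allI impI)
    fix t i assume t: "t \<in> tensor_tuples Ms"
    then have xt: "x # t \<in> tensor_tuples (M # Ms)" using x by (simp add: tensor_tuples_simps)
    then show "F (x # t) \<in> carrier N" by (rule multilinear_closed[OF L])
    show "linear_map K (Ms ! i) N (\<lambda>a. F (x # t[i := a]))" if "i < length Ms"
      using multilinear_slot[OF L xt, of "Suc i"] that by simp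
  qed
  moreover have "linear_map K M N (\<lambda>x. F (x # xs))" if "xs \<in> tensor_tuples Ms" for xs
    \<comment> \<open>The first entry is overwritten, so any element of \<open>M\<close> completes the tuple.\<close>
    using multilinear_slot[OF L, of "\<zero>\<^bsub>M\<^esub> # xs" 0] that by (simp add: tensor_tuples_simps)
  ultimately show ?R by blast
next
  assume R: ?R
  show ?L
    unfolding multilinear_def
  proof (intro ballI conjI allI impI)
    fix t i assume "t \<in> tensor_tuples (M # Ms)"
    then obtain x xs where t: "t = x # xs" "x \<in> carrier M" "xs \<in> tensor_tuples Ms"
      by (auto simp: tensor_tuples_simps)
    then show "F t \<in> carrier N" using R multilinear_closed by fastforce
    show "linear_map K ((M # Ms) ! i) N (\<lambda>a. F (t[i := a]))" if i: "i < length (M # Ms)"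
    proof (cases i)
      case 0
      then show ?thesis using R t by simp
    next
      case (Suc j)
      then show ?thesis
        using R t i multilinear_slot[of K Ms N "\<lambda>xs. F (x # xs)" xs j] by simp
    qed
  qed
qed

lemma multilinear_comp:
  "multilinear K Ms N F \<Longrightarrow> linear_map K N L h \<Longrightarrow> multilinear K Ms L (\<lambda>t. h (F t))"
  unfolding multilinear_def using linear_map_closed linear_map_comp by fast

context
  fixes K :: "('k, 'c) ring_scheme" and Ms :: "('k, 'm) module list"
  assumes K: "cring K" and Ms: "\<forall>M\<in>set Ms. module K M"
begin

lemma multilinear_relations_carrier:
  "multilinear_relations K Ms \<subseteq> carrier (free_module K (tensor_tuples Ms))"
proof -
  interpret F: module K "free_module K (tensor_tuples Ms)" by (rule free_module_module[OF K])
  have m: "module K (Ms ! i)" if "i < length Ms" for i using Ms that by simp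
  have ag: "abelian_monoid (Ms ! i)" if "i < length Ms" for i
    using m[OF that] by (simp add: module_def abelian_group_def)
  note e = basis_elem_closed[OF K tensor_tuples_update]
  show ?thesis
    by (auto simp: multilinear_relations_def Let_def e module.smult_closed[OF m]
        abelian_monoid.a_closed[OF ag])
qed

lemma tensor_null_submodule:
  "submodule (tensor_null K Ms) K (free_module K (tensor_tuples Ms))"
  unfolding tensor_null_def
  by (rule generated_submodule_submodule[OF free_module_module[OF K] multilinear_relations_carrier])

lemma tensor_product_module: "module K (tensor_product K Ms)"
  unfolding tensor_product_def
  by (rule quotient_module_module[OF free_module_module[OF K] tensor_null_submodule])

text \<open>
  Each multilinear relation is divided out, so the two sides of the corresponding identity between
  basis elements have the same coset.
\<close>

lemma pure_tensor_multilinear: "multilinear K Ms (tensor_product K Ms) (pure_tensor K Ms)"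
  unfolding multilinear_def
proof (intro ballI conjI allI impI)
  let ?T = "tensor_tuples Ms" and ?F = "free_module K (tensor_tuples Ms)"
  interpret F: module K ?F by (rule free_module_module[OF K])
  note q = coset_map_linear[OF free_module_module[OF K] tensor_null_submodule, folded tensor_product_def]
  note eqI = coset_eqI[OF free_module_module[OF K] tensor_null_submodule]
  fix t assume t: "t \<in> ?T"
  have closed: "pure_tensor K Ms t \<in> carrier (tensor_product K Ms)" if "t \<in> ?T" for t
    unfolding pure_tensor_def by (rule linear_map_closed[OF q basis_elem_closed[OF K that]])
  then show "pure_tensor K Ms t \<in> carrier (tensor_product K Ms)" using t .
  fix i assume i: "i < length Ms"
  interpret Mi: module K "Ms ! i" using Ms i by simp
  note up = tensor_tuples_update[OF t i]
  note e = basis_elem_closed[OF K up]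
  show "linear_map K (Ms ! i) (tensor_product K Ms) (\<lambda>a. pure_tensor K Ms (t[i := a]))"
  proof (rule linear_mapI)
    show "pure_tensor K Ms (t[i := a]) \<in> carrier (tensor_product K Ms)" if "a \<in> carrier (Ms ! i)" for a
      by (rule closed[OF up[OF that]])
  next
    fix a b assume a: "a \<in> carrier (Ms ! i)" and b: "b \<in> carrier (Ms ! i)"
    have "basis_elem K ?T (t[i := a \<oplus>\<^bsub>Ms ! i\<^esub> b]) \<ominus>\<^bsub>?F\<^esub>
        (basis_elem K ?T (t[i := a]) \<oplus>\<^bsub>?F\<^esub> basis_elem K ?T (t[i := b])) \<in> multilinear_relations K Ms"
      unfolding multilinear_relations_def Let_def using t i a b by (intro UnI1) blast
    then have "basis_elem K ?T (t[i := a \<oplus>\<^bsub>Ms ! i\<^esub> b]) \<ominus>\<^bsub>?F\<^esub>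
        (basis_elem K ?T (t[i := a]) \<oplus>\<^bsub>?F\<^esub> basis_elem K ?T (t[i := b])) \<in> tensor_null K Ms"
      unfolding tensor_null_def by (rule subsetD[OF generated_submodule_incl])
    then have "pure_tensor K Ms (t[i := a \<oplus>\<^bsub>Ms ! i\<^esub> b]) =
        tensor_null K Ms +>\<^bsub>?F\<^esub> (basis_elem K ?T (t[i := a]) \<oplus>\<^bsub>?F\<^esub> basis_elem K ?T (t[i := b]))"
      unfolding pure_tensor_def using a b e by (intro eqI) auto
    then show "pure_tensor K Ms (t[i := a \<oplus>\<^bsub>Ms ! i\<^esub> b]) =
        pure_tensor K Ms (t[i := a]) \<oplus>\<^bsub>tensor_product K Ms\<^esub> pure_tensor K Ms (t[i := b])"
      using a b e by (simp add: linear_map_add[OF q] pure_tensor_def)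
  next
    fix c a assume c: "c \<in> carrier K" and a: "a \<in> carrier (Ms ! i)"
    have "basis_elem K ?T (t[i := c \<odot>\<^bsub>Ms ! i\<^esub> a]) \<ominus>\<^bsub>?F\<^esub>
        (c \<odot>\<^bsub>?F\<^esub> basis_elem K ?T (t[i := a])) \<in> multilinear_relations K Ms"
      unfolding multilinear_relations_def Let_def using t i a c by (intro UnI2) blast
    then have "basis_elem K ?T (t[i := c \<odot>\<^bsub>Ms ! i\<^esub> a]) \<ominus>\<^bsub>?F\<^esub>
        (c \<odot>\<^bsub>?F\<^esub> basis_elem K ?T (t[i := a])) \<in> tensor_null K Ms"
      unfolding tensor_null_def by (rule subsetD[OF generated_submodule_incl])
    then have "pure_tensor K Ms (t[i := c \<odot>\<^bsub>Ms ! i\<^esub> a]) =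
        tensor_null K Ms +>\<^bsub>?F\<^esub> (c \<odot>\<^bsub>?F\<^esub> basis_elem K ?T (t[i := a]))"
      unfolding pure_tensor_def using a c e by (intro eqI) auto
    then show "pure_tensor K Ms (t[i := c \<odot>\<^bsub>Ms ! i\<^esub> a]) =
        c \<odot>\<^bsub>tensor_product K Ms\<^esub> pure_tensor K Ms (t[i := a])"
      using a c e by (simp add: linear_map_smult[OF q] pure_tensor_def)
  qed
qed

lemma pure_tensor_closed: "t \<in> tensor_tuples Ms \<Longrightarrow> pure_tensor K Ms t \<in> carrier (tensor_product K Ms)"
  by (rule multilinear_closed[OF pure_tensor_multilinear])

lemma tensor_product_spanned:
  assumes H: "submodule H K (tensor_product K Ms)"
    and pure: "\<And>t. t \<in> tensor_tuples Ms \<Longrightarrow> pure_tensor K Ms t \<in> H"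
    and A: "A \<in> carrier (tensor_product K Ms)"
  shows "A \<in> H"
proof -
  let ?F = "free_module K (tensor_tuples Ms)" and ?q = "\<lambda>f. tensor_null K Ms +>\<^bsub>free_module K (tensor_tuples Ms)\<^esub> f"
  note F = free_module_module[OF K, of "tensor_tuples Ms"]
  note q = coset_map_linear[OF F tensor_null_submodule, folded tensor_product_def]
  note H' = vimage_submodule[OF F tensor_product_module q H]
  obtain f where f: "f \<in> carrier ?F" "A = ?q f"
    using A coset_map_onto[OF F tensor_null_submodule] unfolding tensor_product_def by blast
  have "f \<in> {f \<in> carrier ?F. ?q f \<in> H}"
    by (rule free_module_spanned[OF K H' _ f(1)])
       (use pure in \<open>simp add: basis_elem_closed[OF K] pure_tensor_def\<close>)
  then show ?thesis using f by simp
qed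

lemma linear_eq_on_pure_tensors:
  assumes N: "module K N" and g: "linear_map K (tensor_product K Ms) N g"
    and h: "linear_map K (tensor_product K Ms) N h"
    and eq: "\<And>t. t \<in> tensor_tuples Ms \<Longrightarrow> g (pure_tensor K Ms t) = h (pure_tensor K Ms t)"
    and A: "A \<in> carrier (tensor_product K Ms)"
  shows "g A = h A"
  using tensor_product_spanned[OF equalizer_submodule[OF tensor_product_module N g h] _ A] eq
    pure_tensor_closed by blast

text \<open>
  The universal property of the tensor product. The linear extension of a multilinear map to the
  free module on tuples kills the defining relations, hence the submodule they generate, so it is
  constant on every coset and the representative chosen in \<open>tensor_lift\<close> does not matter.
\<close>

lemma
  fixes N :: "('k, 'n) module"
  assumes N: "module K N" and mult: "multilinear K Ms N F"
  shows tensor_lift_linear: "linear_map K (tensor_product K Ms) N (tensor_lift K Ms N F)"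
    and tensor_lift_pure: "t \<in> tensor_tuples Ms \<Longrightarrow> tensor_lift K Ms N F (pure_tensor K Ms t) = F t"
proof -
  let ?T = "tensor_tuples Ms" and ?F = "free_module K (tensor_tuples Ms)"
  let ?q = "\<lambda>f. tensor_null K Ms +>\<^bsub>?F\<^esub> f" and ?l = "free_lift K ?T N F"
  interpret N: module K N by fact
  interpret F: module K ?F by (rule free_module_module[OF K])
  note FM = free_module_module[OF K, of ?T]
  note q = coset_map_linear[OF FM tensor_null_submodule, folded tensor_product_def]
  note l = free_lift_linear[OF N, where F = F and Y = ?T, OF multilinear_closed[OF mult]]
  note lb = free_lift_basis[OF N, where F = F and Y = ?T, OF multilinear_closed[OF mult]]
  note e = basis_elem_closed[OF K]
  note up = tensor_tuples_update
  have "multilinear_relations K Ms \<subseteq> {f \<in> carrier ?F. ?l f = \<zero>\<^bsub>N\<^esub>}"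
  proof
    fix f assume f: "f \<in> multilinear_relations K Ms"
    then have fc: "f \<in> carrier ?F" using multilinear_relations_carrier by blast
    from f consider
      (add) t i a b where "f = basis_elem K ?T (t[i := a \<oplus>\<^bsub>Ms ! i\<^esub> b]) \<ominus>\<^bsub>?F\<^esub>
          (basis_elem K ?T (t[i := a]) \<oplus>\<^bsub>?F\<^esub> basis_elem K ?T (t[i := b]))"
        "t \<in> ?T" "i < length Ms" "a \<in> carrier (Ms ! i)" "b \<in> carrier (Ms ! i)"
      | (smult) t i c a where "f = basis_elem K ?T (t[i := c \<odot>\<^bsub>Ms ! i\<^esub> a]) \<ominus>\<^bsub>?F\<^esub>
          (c \<odot>\<^bsub>?F\<^esub> basis_elem K ?T (t[i := a]))"
        "t \<in> ?T" "i < length Ms" "c \<in> carrier K" "a \<in> carrier (Ms ! i)"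
      unfolding multilinear_relations_def Let_def by blast
    then have "?l f = \<zero>\<^bsub>N\<^esub>"
    proof cases
      case add
      interpret Mi: module K "Ms ! i" using Ms add(3) by simp
      note sl = multilinear_slot[OF mult add(2,3)]
      show ?thesis
        unfolding add(1)
        by (rule linear_map_diff_eq_zero[OF FM N l])
           (use add in \<open>auto simp: e up linear_map_add[OF l] lb linear_map_add[OF sl]\<close>)
    next
      case smult
      interpret Mi: module K "Ms ! i" using Ms smult(3) by simp
      note sl = multilinear_slot[OF mult smult(2,3)]
      show ?thesis
        unfolding smult(1)
        by (rule linear_map_diff_eq_zero[OF FM N l])
           (use smult in \<open>auto simp: e up linear_map_smult[OF l] lb linear_map_smult[OF sl]\<close>)
    qed
    then show "f \<in> {f \<in> carrier ?F. ?l f = \<zero>\<^bsub>N\<^esub>}" using fc by simp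
  qed
  then have null: "?l f = \<zero>\<^bsub>N\<^esub>" if "f \<in> tensor_null K Ms" for f
    using generated_submodule_least[OF equalizer_submodule[OF FM N l linear_map_const_zero[OF N]]] that
    unfolding tensor_null_def by blast
  have coset: "tensor_lift K Ms N F (?q f) = ?l f" if f: "f \<in> carrier ?F" for f
  proof -
    have "\<zero>\<^bsub>?F\<^esub> \<oplus>\<^bsub>?F\<^esub> f \<in> ?q f"
      unfolding a_r_coset_def' using submodule_zero[OF tensor_null_submodule] by blast
    then have "(SOME g. g \<in> ?q f) \<in> ?q f" by (rule someI[of "\<lambda>g. g \<in> ?q f"])
    then obtain s where s: "s \<in> tensor_null K Ms" "(SOME g. g \<in> ?q f) = s \<oplus>\<^bsub>?F\<^esub> f"
      unfolding a_r_coset_def' by blast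
    then have "s \<in> carrier ?F" using submodule_subset[OF tensor_null_submodule] by blast
    then have "?l (SOME g. g \<in> ?q f) = ?l f"
      unfolding s(2) using s(1) f linear_map_closed[OF l f] by (simp add: linear_map_add[OF l] null)
    then show ?thesis
      by (simp add: tensor_lift_def free_lift_def Let_def)
  qed
  show "tensor_lift K Ms N F (pure_tensor K Ms t) = F t" if "t \<in> ?T"
    using that by (simp add: pure_tensor_def coset e lb)
  show "linear_map K (tensor_product K Ms) N (tensor_lift K Ms N F)"
  proof (rule linear_mapI)
    have onto: "\<exists>f\<in>carrier ?F. A = ?q f" if "A \<in> carrier (tensor_product K Ms)" for A
      using that coset_map_onto[OF FM tensor_null_submodule] unfolding tensor_product_def by blast
    {
      fix A assume "A \<in> carrier (tensor_product K Ms)"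
      then obtain f where f: "f \<in> carrier ?F" "A = ?q f" using onto by blast
      then show "tensor_lift K Ms N F A \<in> carrier N"
        using linear_map_closed[OF l] by (simp add: coset)
      fix B assume "B \<in> carrier (tensor_product K Ms)"
      then obtain g where g: "g \<in> carrier ?F" "B = ?q g" using onto by blast
      show "tensor_lift K Ms N F (A \<oplus>\<^bsub>tensor_product K Ms\<^esub> B) =
          tensor_lift K Ms N F A \<oplus>\<^bsub>N\<^esub> tensor_lift K Ms N F B"
        using f g by (simp add: linear_map_add[OF q, symmetric] coset linear_map_add[OF l])
    next
      fix c A assume c: "c \<in> carrier K" and "A \<in> carrier (tensor_product K Ms)"
      then obtain f where f: "f \<in> carrier ?F" "A = ?q f" using onto by blast
      show "tensor_lift K Ms N F (c \<odot>\<^bsub>tensor_product K Ms\<^esub> A) = c \<odot>\<^bsub>N\<^esub> tensor_lift K Ms N F A"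
        using f c by (simp add: linear_map_smult[OF q, symmetric] coset linear_map_smult[OF l])
    }
  qed
qed

end


section \<open>Modules over an algebra, with scalars restricted\<close>

lemma abelian_group_transfer:
  assumes "abelian_group M"
    and "carrier M = carrier N" "add M = add N" "\<zero>\<^bsub>M\<^esub> = \<zero>\<^bsub>N\<^esub>"
  shows "abelian_group N"
proof -
  interpret M: abelian_group M by fact
  show ?thesis
  proof (rule abelian_groupI)
    show "\<exists>y\<in>carrier N. y \<oplus>\<^bsub>N\<^esub> x = \<zero>\<^bsub>N\<^esub>" if "x \<in> carrier N" for x
      using that M.l_neg[of x] M.a_inv_closed[of x] by (auto simp flip: assms(2-4))
  qed (simp_all flip: assms(2-4) add: M.add.m_ac)
qed

lemma restrict_scalars_simps [simp]:
  "carrier (restrict_scalars R M) = carrier M"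
  "\<zero>\<^bsub>restrict_scalars R M\<^esub> = \<zero>\<^bsub>M\<^esub>"
  "x \<oplus>\<^bsub>restrict_scalars R M\<^esub> y = x \<oplus>\<^bsub>M\<^esub> y"
  "c \<odot>\<^bsub>restrict_scalars R M\<^esub> x = (c \<odot>\<^bsub>R\<^esub> \<one>\<^bsub>R\<^esub>) \<odot>\<^bsub>M\<^esub> x"
  by (simp_all add: restrict_scalars_def)

lemma linear_operator_iff: "linear_operator K M h \<longleftrightarrow> linear_map K M M h"
  by (simp add: linear_operator_def linear_map_def)

context
  fixes K :: "('k, 'c) ring_scheme" and R :: "('k, 'r, 'd) module_scheme"
  assumes R: "assoc_algebra K R"
begin

interpretation R: assoc_algebra K R by (rule R)

text \<open>The image of \<open>K\<close> under \<open>c \<mapsto> c \<odot> \<one>\<close> is central in \<open>R\<close>.\<close>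

lemma scalar_mult:
  assumes "c \<in> carrier K" "r \<in> carrier R"
  shows "(c \<odot>\<^bsub>R\<^esub> \<one>\<^bsub>R\<^esub>) \<otimes>\<^bsub>R\<^esub> r = c \<odot>\<^bsub>R\<^esub> r" and "r \<otimes>\<^bsub>R\<^esub> (c \<odot>\<^bsub>R\<^esub> \<one>\<^bsub>R\<^esub>) = c \<odot>\<^bsub>R\<^esub> r"
  using assms by (simp_all add: R.smult_mult_left R.smult_mult_right)

lemma restrict_scalars_module:
  assumes M: "left_module R M"
  shows "module K (restrict_scalars R M)"
proof -
  interpret M: left_module R M by fact
  show ?thesis
  proof (rule moduleI)
    show "cring K" by (rule R.is_cring)
    show "abelian_group (restrict_scalars R M)"
      by (rule abelian_group_transfer[of M]) (auto simp: M.abelian_group_axioms fun_eq_iff)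
    fix a b x assume a: "a \<in> carrier K" and b: "b \<in> carrier K" and x: "x \<in> carrier (restrict_scalars R M)"
    have "((a \<otimes>\<^bsub>K\<^esub> b) \<odot>\<^bsub>R\<^esub> \<one>\<^bsub>R\<^esub>) = (a \<odot>\<^bsub>R\<^esub> \<one>\<^bsub>R\<^esub>) \<otimes>\<^bsub>R\<^esub> (b \<odot>\<^bsub>R\<^esub> \<one>\<^bsub>R\<^esub>)"
      using a b by (simp add: R.smult_mult_left R.smult_assoc1)
    then show "(a \<otimes>\<^bsub>K\<^esub> b) \<odot>\<^bsub>restrict_scalars R M\<^esub> x = a \<odot>\<^bsub>restrict_scalars R M\<^esub> (b \<odot>\<^bsub>restrict_scalars R M\<^esub> x)"
      using a b x by (simp add: M.smult_assoc1)
  qed (auto simp: M.smult_closed M.smult_l_distr M.smult_r_distr M.smult_one R.smult_l_distr)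
qed

text \<open>
  The action of \<open>r\<close> on a left \<open>R\<close>-module is only \<open>K\<close>-linear in general: \<open>R\<close> need not be
  commutative, but the scalars from \<open>K\<close> commute with \<open>r\<close>.
\<close>

lemma left_module_scale_linear:
  assumes M: "left_module R M" and r: "r \<in> carrier R"
  shows "linear_map K (restrict_scalars R M) (restrict_scalars R M) (\<lambda>x. r \<odot>\<^bsub>M\<^esub> x)"
proof -
  interpret M: left_module R M by fact
  show ?thesis
    using r by (intro linear_mapI)
      (auto simp: M.smult_closed M.smult_r_distr M.smult_assoc1[symmetric] scalar_mult)
qed

lemma left_module_orbit_linear:
  assumes M: "left_module R M" and x: "x \<in> carrier M"
  shows "linear_map K R (restrict_scalars R M) (\<lambda>r. r \<odot>\<^bsub>M\<^esub> x)"
proof -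
  interpret M: left_module R M by fact
  show ?thesis
    using x by (intro linear_mapI)
      (auto simp: M.smult_closed M.smult_l_distr M.smult_assoc1[symmetric] scalar_mult)
qed

lemma left_mult_linear:
  assumes r: "r \<in> carrier R"
  shows "linear_map K R R (\<lambda>s. r \<otimes>\<^bsub>R\<^esub> s)"
  using r by (intro linear_mapI) (auto simp: R.smult_mult_right R.r_distr)

end

text \<open>
  Here the point \<open>p\<close> of the free module is fixed and the values prescribed on the basis vary. This
  makes \<open>\<Sum>\<^sub>\<omega> p(\<omega>) \<nn>\<^sub>\<omega>(v)\<close> linear in \<open>v\<close>. The points \<open>p\<close> with this property form a submodule
  that contains the basis.
\<close>

lemma free_lift_linear_param:
  assumes L: "module K L" and N: "module K N" and G: "\<And>y. y \<in> Y \<Longrightarrow> linear_map K L N (G y)"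
    and p: "p \<in> carrier (free_module K Y)"
  shows "linear_map K L N (\<lambda>v. free_lift K Y N (\<lambda>y. G y v) p)"
proof -
  interpret L: module K L by fact
  interpret N: module K N by fact
  have K: "cring K" by (rule L.is_cring)
  note F = free_module_module[OF K, of Y]
  interpret F: module K "free_module K Y" by (rule F)
  let ?G = "\<lambda>v y. G y v"
  have lin: "linear_map K (free_module K Y) N (free_lift K Y N (?G v))" if "v \<in> carrier L" for v
    by (rule free_lift_linear[OF N]) (rule linear_map_closed[OF G that])
  let ?H = "{p \<in> carrier (free_module K Y). linear_map K L N (\<lambda>v. free_lift K Y N (?G v) p)}"
  have sub: "submodule ?H K (free_module K Y)"
  proof (rule submodule_by_smult[OF F])
    show "\<zero>\<^bsub>free_module K Y\<^esub> \<in> ?H"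
      using linear_map_const_zero[OF N]
        linear_map_cong[OF L, of "\<lambda>v. free_lift K Y N (?G v) \<zero>\<^bsub>free_module K Y\<^esub>" "\<lambda>_. \<zero>\<^bsub>N\<^esub>" N]
      by (simp add: linear_map_zero[OF F N lin])
    show "p \<oplus>\<^bsub>free_module K Y\<^esub> q \<in> ?H" if p: "p \<in> ?H" and q: "q \<in> ?H" for p q
      using linear_map_pointwise_add[OF N, of L "\<lambda>v. free_lift K Y N (?G v) p" "\<lambda>v. free_lift K Y N (?G v) q"] p q
        linear_map_cong[OF L, of "\<lambda>v. free_lift K Y N (?G v) (p \<oplus>\<^bsub>free_module K Y\<^esub> q)"
          "\<lambda>v. free_lift K Y N (?G v) p \<oplus>\<^bsub>N\<^esub> free_lift K Y N (?G v) q" N]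
      by (simp add: linear_map_add[OF lin])
    show "c \<odot>\<^bsub>free_module K Y\<^esub> p \<in> ?H" if c: "c \<in> carrier K" and p: "p \<in> ?H" for c p
      using linear_map_comp[OF _ linear_map_scale[OF N c], of L "\<lambda>v. free_lift K Y N (?G v) p"] p c
        linear_map_cong[OF L, of "\<lambda>v. free_lift K Y N (?G v) (c \<odot>\<^bsub>free_module K Y\<^esub> p)"
          "\<lambda>v. c \<odot>\<^bsub>N\<^esub> free_lift K Y N (?G v) p" N]
      by (simp add: linear_map_smult[OF lin])
  qed auto
  have basis: "basis_elem K Y y \<in> ?H" if y: "y \<in> Y" for y
  proof -
    have "free_lift K Y N (?G v) (basis_elem K Y y) = G y v" if "v \<in> carrier L" for v
      by (rule free_lift_basis[OF N _ y, where F = "?G v"]) (rule linear_map_closed[OF G that])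
    then have "linear_map K L N (\<lambda>v. free_lift K Y N (?G v) (basis_elem K Y y))"
      using linear_map_cong[OF L, of "\<lambda>v. free_lift K Y N (?G v) (basis_elem K Y y)" "G y" N] G[OF y] by simp
    then show ?thesis by (simp add: basis_elem_closed[OF K y])
  qed
  have "p \<in> ?H" by (rule free_module_spanned[OF K sub basis p])
  then show ?thesis by simp
qed


section \<open>The operated module \<open>M\<^sub>R(X)\<close>\<close>

text \<open>
  The value that the homomorphism extending \<open>f\<close> must take on a pure tensor: the tensor
  \<open>r\<^sub>1 \<otimes> \<omega>\<^sub>1 \<otimes> \<dots> \<otimes> r\<^sub>n \<otimes> x\<close> is \<open>r\<^sub>1 \<mm>'\<^sub>\<omega>\<^sub>1(r\<^sub>2 \<mm>'\<^sub>\<omega>\<^sub>2(\<dots> r\<^sub>n j(x)))\<close> in \<open>M\<^sub>R(X)\<close>. The slots for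
  \<open>\<Omega>\<close> and \<open>X\<close> hold arbitrary elements of free modules, so the formula is extended linearly there.
  The last equation covers lists that are not tuples of factors.
\<close>

fun eval_word ::
    "('k, 'c) ring_scheme \<Rightarrow> ('k, 'r, 'd) module_scheme \<Rightarrow> 'w set \<Rightarrow> 'x set \<Rightarrow>
     ('r, 'n, 'e) module_scheme \<Rightarrow> ('w \<Rightarrow> 'n \<Rightarrow> 'n) \<Rightarrow> ('x \<Rightarrow> 'n) \<Rightarrow> ('r, 'w, 'x, 'k) slot list \<Rightarrow> 'n" where
  "eval_word K R \<Omega> X N \<nn> f [Alg r, Gen g] = r \<odot>\<^bsub>N\<^esub> free_lift K X (restrict_scalars R N) f g"
| "eval_word K R \<Omega> X N \<nn> f (Alg r # Op p # t) =
    r \<odot>\<^bsub>N\<^esub> free_lift K \<Omega> (restrict_scalars R N) (\<lambda>\<omega>. \<nn> \<omega> (eval_word K R \<Omega> X N \<nn> f t)) p"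
| "eval_word K R \<Omega> X N \<nn> f _ = \<zero>\<^bsub>N\<^esub>"

lemma factors_simps:
  "factors K R \<Omega> X (Suc 0) = [module_copy Alg R, module_copy Gen (free_module K X)]"
  "n \<ge> 1 \<Longrightarrow> factors K R \<Omega> X (Suc n) =
    module_copy Alg R # module_copy Op (free_module K \<Omega>) # factors K R \<Omega> X n"
  by (cases n; simp add: factors_def)+

lemma factors_obtain_tail:
  obtains Ms where "factors K R \<Omega> X n = module_copy Alg R # Ms"
  by (cases "n - 1") (auto simp: factors_def)

lemma inj_slots: "inj Alg" "inj Op" "inj Gen"
  by (auto simp: inj_def)

text \<open>
  The \<open>K\<close>-module underlying \<open>M\<^sub>R(X)\<close>. Linearity is studied on it because the tensor products are
  \<open>K\<close>-modules; \<open>MR_scalar\<close> below identifies its scalars with those that \<open>R\<close> induces.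
\<close>

abbreviation MR_sum ::
    "('k, 'c) ring_scheme \<Rightarrow> ('k, 'r, 'd) module_scheme \<Rightarrow> 'w set \<Rightarrow> 'x set \<Rightarrow>
     ('k, nat \<Rightarrow> (('r, 'w, 'x, 'k) slot list \<Rightarrow> 'k) set) module" where
  "MR_sum K R \<Omega> X \<equiv> direct_sum {1..} (MR_summand K R \<Omega> X)"

definition homogeneous where
  "homogeneous K R \<Omega> X n = single {1..} (MR_summand K R \<Omega> X) n"

definition summand_action where
  "summand_action K R \<Omega> X n r =
    tensor_lift K (factors K R \<Omega> X n) (MR_summand K R \<Omega> X n)
      (\<lambda>t. MR_pure K R \<Omega> X n (Alg (r \<otimes>\<^bsub>R\<^esub> the_alg (hd t)) # tl t))"

definition summand_shift where
  "summand_shift K R \<Omega> X n \<omega> =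
    tensor_lift K (factors K R \<Omega> X n) (MR_summand K R \<Omega> X (Suc n))
      (\<lambda>t. MR_pure K R \<Omega> X (Suc n) (Alg \<one>\<^bsub>R\<^esub> # Op (basis_elem K \<Omega> \<omega>) # t))"

lemma MR_simps:
  "carrier (MR K R \<Omega> X) = carrier (MR_sum K R \<Omega> X)"
  "\<zero>\<^bsub>MR K R \<Omega> X\<^esub> = \<zero>\<^bsub>MR_sum K R \<Omega> X\<^esub>"
  "u \<oplus>\<^bsub>MR K R \<Omega> X\<^esub> v = u \<oplus>\<^bsub>MR_sum K R \<Omega> X\<^esub> v"
  "r \<odot>\<^bsub>MR K R \<Omega> X\<^esub> u = (\<lambda>n\<in>{1..}. summand_action K R \<Omega> X n r (u n))"
  by (simp_all add: MR_def Let_def summand_action_def)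

lemma MR_operator_shift:
  "MR_operator K R \<Omega> X \<omega> u = (\<lambda>n\<in>{1..}.
    if n = 1 then \<zero>\<^bsub>MR_summand K R \<Omega> X 1\<^esub> else summand_shift K R \<Omega> X (n - 1) \<omega> (u (n - 1)))"
  by (auto simp: MR_operator_def summand_shift_def intro!: restrict_ext)

lemma MR_gen_homogeneous:
  "MR_gen K R \<Omega> X x =
    homogeneous K R \<Omega> X 1 (MR_pure K R \<Omega> X 1 [Alg \<one>\<^bsub>R\<^esub>, Gen (basis_elem K X x)])"
  by (auto simp: MR_gen_def homogeneous_def single_def intro!: restrict_ext)

context
  fixes K :: "('k, 'c) ring_scheme" and R :: "('k, 'r, 'd) module_scheme"
    and \<Omega> :: "'w set" and X :: "'x set"
  assumes R: "assoc_algebra K R"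
begin

interpretation R: assoc_algebra K R by (rule R)

lemma K_cring: "cring K"
  by (rule R.is_cring)

lemma R_module: "module K R"
  by (rule R.module_axioms)

lemma slot_modules:
  "module K (module_copy Alg R)" "module K (module_copy Op (free_module K \<Omega>))"
  "module K (module_copy Gen (free_module K X))"
  by (rule module_copy_module R_module free_module_module K_cring inj_slots)+

lemma factors_modules: "\<forall>M\<in>set (factors K R \<Omega> X n). module K M"
  using slot_modules by (auto simp: factors_def)

lemma summand_module: "module K (MR_summand K R \<Omega> X n)"
  unfolding MR_summand_def by (rule tensor_product_module[OF K_cring factors_modules])

lemma MR_sum_module: "module K (MR_sum K R \<Omega> X)"
  by (rule direct_sum_module[OF K_cring summand_module])

lemma MR_pure_multilinear: "multilinear K (factors K R \<Omega> X n) (MR_summand K R \<Omega> X n) (MR_pure K R \<Omega> X n)"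
  unfolding MR_summand_def MR_pure_def by (rule pure_tensor_multilinear[OF K_cring factors_modules])

lemmas MR_pure_closed = multilinear_closed[OF MR_pure_multilinear]

lemma MR_pure_Alg_linear:
  assumes "factors K R \<Omega> X n = module_copy Alg R # Ms" "t \<in> tensor_tuples Ms"
  shows "linear_map K R (MR_summand K R \<Omega> X n) (\<lambda>r. MR_pure K R \<Omega> X n (Alg r # t))"
  using MR_pure_multilinear[of n] assms
  by (simp add: multilinear_Cons slot_modules linear_map_from_copy R_module inj_slots)

lemma
  assumes r: "r \<in> carrier R"
  shows summand_action_linear:
      "linear_map K (MR_summand K R \<Omega> X n) (MR_summand K R \<Omega> X n) (summand_action K R \<Omega> X n r)" (is ?lin)
    and summand_action_pure:
      "Alg s # t \<in> tensor_tuples (factors K R \<Omega> X n) \<Longrightarrow>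
        summand_action K R \<Omega> X n r (MR_pure K R \<Omega> X n (Alg s # t)) =
        MR_pure K R \<Omega> X n (Alg (r \<otimes>\<^bsub>R\<^esub> s) # t)"
proof -
  obtain Ms where Ms: "factors K R \<Omega> X n = module_copy Alg R # Ms" by (rule factors_obtain_tail)
  have "multilinear K (factors K R \<Omega> X n) (MR_summand K R \<Omega> X n)
      (\<lambda>t. MR_pure K R \<Omega> X n (Alg (r \<otimes>\<^bsub>R\<^esub> the_alg (hd t)) # tl t))"
    unfolding Ms multilinear_Cons[OF slot_modules(1)]
  proof (intro conjI ballI)
    fix x :: "('r, 'w, 'x, 'k) slot"
    assume "x \<in> carrier (module_copy Alg R)"
    then show "multilinear K Ms (MR_summand K R \<Omega> X n)
        (\<lambda>xs. MR_pure K R \<Omega> X n (Alg (r \<otimes>\<^bsub>R\<^esub> the_alg (hd (x # xs))) # tl (x # xs)))"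
      using MR_pure_multilinear[of n] r
      by (auto simp: Ms multilinear_Cons[OF slot_modules(1)] carrier_module_copy)
  next
    fix xs assume xs: "xs \<in> tensor_tuples Ms"
    show "linear_map K (module_copy Alg R) (MR_summand K R \<Omega> X n)
        (\<lambda>x. MR_pure K R \<Omega> X n (Alg (r \<otimes>\<^bsub>R\<^esub> the_alg (hd (x # xs))) # tl (x # xs)))"
      using linear_map_comp[OF left_mult_linear[OF R r] MR_pure_Alg_linear[OF Ms xs]]
      by (simp add: linear_map_from_copy R_module inj_slots)
  qed
  note lift = this
  show ?lin
    unfolding summand_action_def
    using tensor_lift_linear[OF K_cring factors_modules summand_module lift]
    by (simp add: MR_summand_def)
  show "summand_action K R \<Omega> X n r (MR_pure K R \<Omega> X n (Alg s # t)) = MR_pure K R \<Omega> X n (Alg (r \<otimes>\<^bsub>R\<^esub> s) # t)"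
    if "Alg s # t \<in> tensor_tuples (factors K R \<Omega> X n)"
    unfolding summand_action_def
    using tensor_lift_pure[OF K_cring factors_modules summand_module lift that]
    by (simp add: MR_pure_def)
qed

lemma one_slot: "Alg \<one>\<^bsub>R\<^esub> \<in> carrier (module_copy Alg R)"
  by (simp add: carrier_module_copy)

lemma basis_slot: "\<omega> \<in> \<Omega> \<Longrightarrow> Op (basis_elem K \<Omega> \<omega>) \<in> carrier (module_copy Op (free_module K \<Omega>))"
  "x \<in> X \<Longrightarrow> Gen (basis_elem K X x) \<in> carrier (module_copy Gen (free_module K X))"
  by (simp_all add: carrier_module_copy basis_elem_closed[OF K_cring])

lemma
  assumes \<omega>: "\<omega> \<in> \<Omega>" and n: "n \<ge> 1"
  shows summand_shift_linear:
      "linear_map K (MR_summand K R \<Omega> X n) (MR_summand K R \<Omega> X (Suc n)) (summand_shift K R \<Omega> X n \<omega>)" (is ?lin)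
    and summand_shift_pure:
      "t \<in> tensor_tuples (factors K R \<Omega> X n) \<Longrightarrow>
        summand_shift K R \<Omega> X n \<omega> (MR_pure K R \<Omega> X n t) =
        MR_pure K R \<Omega> X (Suc n) (Alg \<one>\<^bsub>R\<^esub> # Op (basis_elem K \<Omega> \<omega>) # t)"
proof -
  have lift: "multilinear K (factors K R \<Omega> X n) (MR_summand K R \<Omega> X (Suc n))
      (\<lambda>t. MR_pure K R \<Omega> X (Suc n) (Alg \<one>\<^bsub>R\<^esub> # Op (basis_elem K \<Omega> \<omega>) # t))"
    using MR_pure_multilinear[of "Suc n"] one_slot basis_slot(1)[OF \<omega>]
    unfolding factors_simps(2)[OF n] multilinear_Cons[OF slot_modules(1)]
      multilinear_Cons[OF slot_modules(2)] by blast
  show ?lin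
    unfolding summand_shift_def
    using tensor_lift_linear[OF K_cring factors_modules summand_module lift]
    by (simp add: MR_summand_def)
  show "summand_shift K R \<Omega> X n \<omega> (MR_pure K R \<Omega> X n t) =
        MR_pure K R \<Omega> X (Suc n) (Alg \<one>\<^bsub>R\<^esub> # Op (basis_elem K \<Omega> \<omega>) # t)"
    if "t \<in> tensor_tuples (factors K R \<Omega> X n)"
    unfolding summand_shift_def
    using tensor_lift_pure[OF K_cring factors_modules summand_module lift that]
    by (simp add: MR_pure_def)
qed

lemma summand_eq_on_pure:
  assumes N: "module K N" and g: "linear_map K (MR_summand K R \<Omega> X n) N g"
    and h: "linear_map K (MR_summand K R \<Omega> X n) N h"
    and eq: "\<And>s t. s \<in> carrier R \<Longrightarrow> Alg s # t \<in> tensor_tuples (factors K R \<Omega> X n) \<Longrightarrow>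
      g (MR_pure K R \<Omega> X n (Alg s # t)) = h (MR_pure K R \<Omega> X n (Alg s # t))"
    and A: "A \<in> carrier (MR_summand K R \<Omega> X n)"
  shows "g A = h A"
proof (rule linear_eq_on_pure_tensors[OF K_cring factors_modules N])
  obtain Ms where Ms: "factors K R \<Omega> X n = module_copy Alg R # Ms" by (rule factors_obtain_tail)
  fix t assume t: "t \<in> tensor_tuples (factors K R \<Omega> X n)"
  then obtain s t' where "t = Alg s # t'" "s \<in> carrier R"
    by (auto simp: Ms tensor_tuples_simps carrier_module_copy)
  then show "g (pure_tensor K (factors K R \<Omega> X n) t) = h (pure_tensor K (factors K R \<Omega> X n) t)"
    using eq t by (simp add: MR_pure_def)
qed (use g h A in \<open>simp_all add: MR_summand_def\<close>)

lemma homogeneous_linear: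
  "n \<ge> 1 \<Longrightarrow> linear_map K (MR_summand K R \<Omega> X n) (MR_sum K R \<Omega> X) (homogeneous K R \<Omega> X n)"
  unfolding homogeneous_def by (rule single_linear[OF summand_module]) simp

lemma MR_sum_spanned:
  assumes H: "submodule H K (MR_sum K R \<Omega> X)"
    and pure: "\<And>n t. n \<ge> 1 \<Longrightarrow> t \<in> tensor_tuples (factors K R \<Omega> X n) \<Longrightarrow>
      homogeneous K R \<Omega> X n (MR_pure K R \<Omega> X n t) \<in> H"
    and u: "u \<in> carrier (MR_sum K R \<Omega> X)"
  shows "u \<in> H"
proof (rule direct_sum_spanned[OF K_cring summand_module H _ u])
  fix n :: nat and A assume n: "n \<in> {1..}" and A: "A \<in> carrier (MR_summand K R \<Omega> X n)"
  then have "n \<ge> 1" by simp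
  note V = vimage_submodule[OF summand_module MR_sum_module homogeneous_linear[OF this] H]
  have "A \<in> {A \<in> carrier (MR_summand K R \<Omega> X n). homogeneous K R \<Omega> X n A \<in> H}"
    unfolding MR_summand_def
    by (rule tensor_product_spanned[OF K_cring factors_modules V[unfolded MR_summand_def]])
       (use A n pure MR_pure_closed in \<open>auto simp: MR_summand_def MR_pure_def\<close>)
  then show "single {1..} (MR_summand K R \<Omega> X) n A \<in> H" by (simp add: homogeneous_def)
qed

lemma MR_pure_head_linear:
  assumes "Alg s # t \<in> tensor_tuples (factors K R \<Omega> X n)"
  shows "linear_map K R (MR_summand K R \<Omega> X n) (\<lambda>r. MR_pure K R \<Omega> X n (Alg r # t))"
proof -
  obtain Ms where Ms: "factors K R \<Omega> X n = module_copy Alg R # Ms" by (rule factors_obtain_tail)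
  show ?thesis
    by (rule MR_pure_Alg_linear[OF Ms]) (use assms in \<open>simp add: Ms tensor_tuples_simps\<close>)
qed

text \<open>
  Both sides are linear, and on a pure tensor the scalar moves into the first factor.
\<close>

lemma summand_action_scalar:
  assumes c: "c \<in> carrier K" and A: "A \<in> carrier (MR_summand K R \<Omega> X n)"
  shows "summand_action K R \<Omega> X n (c \<odot>\<^bsub>R\<^esub> \<one>\<^bsub>R\<^esub>) A = c \<odot>\<^bsub>MR_summand K R \<Omega> X n\<^esub> A"
proof (rule summand_eq_on_pure[OF summand_module _ linear_map_scale[OF summand_module c] _ A])
  have c1: "c \<odot>\<^bsub>R\<^esub> \<one>\<^bsub>R\<^esub> \<in> carrier R" using c by simp
  show "linear_map K (MR_summand K R \<Omega> X n) (MR_summand K R \<Omega> X n)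
      (summand_action K R \<Omega> X n (c \<odot>\<^bsub>R\<^esub> \<one>\<^bsub>R\<^esub>))"
    by (rule summand_action_linear[OF c1])
  fix s t assume "s \<in> carrier R" "Alg s # t \<in> tensor_tuples (factors K R \<Omega> X n)"
  then show "summand_action K R \<Omega> X n (c \<odot>\<^bsub>R\<^esub> \<one>\<^bsub>R\<^esub>) (MR_pure K R \<Omega> X n (Alg s # t)) =
      c \<odot>\<^bsub>MR_summand K R \<Omega> X n\<^esub> MR_pure K R \<Omega> X n (Alg s # t)"
    using c by (simp add: summand_action_pure[OF c1] scalar_mult[OF R]
        linear_map_smult[OF MR_pure_head_linear])
qed

text \<open>
  Both sides of each law are linear in \<open>A\<close>, so it suffices to compare them on pure tensors, where
  they reduce to the ring laws in the first factor.
\<close>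

lemma summand_action_laws:
  assumes r: "r \<in> carrier R" and s: "s \<in> carrier R" and A: "A \<in> carrier (MR_summand K R \<Omega> X n)"
  shows "summand_action K R \<Omega> X n (r \<oplus>\<^bsub>R\<^esub> s) A =
      summand_action K R \<Omega> X n r A \<oplus>\<^bsub>MR_summand K R \<Omega> X n\<^esub> summand_action K R \<Omega> X n s A"
    and "summand_action K R \<Omega> X n (r \<otimes>\<^bsub>R\<^esub> s) A = summand_action K R \<Omega> X n r (summand_action K R \<Omega> X n s A)"
proof -
  note act = summand_action_linear
  have tuple: "Alg (a \<otimes>\<^bsub>R\<^esub> b) # t \<in> tensor_tuples (factors K R \<Omega> X n)"
    if "Alg b # t \<in> tensor_tuples (factors K R \<Omega> X n)" "a \<in> carrier R" "b \<in> carrier R" for a b t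
    using factors_obtain_tail[of K R \<Omega> X n] that
    by (metis (no_types, lifting) R.m_closed carrier_module_copy image_eqI list.inject tensor_tuples_simps(2))
  show "summand_action K R \<Omega> X n (r \<oplus>\<^bsub>R\<^esub> s) A =
      summand_action K R \<Omega> X n r A \<oplus>\<^bsub>MR_summand K R \<Omega> X n\<^esub> summand_action K R \<Omega> X n s A"
    by (rule summand_eq_on_pure[OF summand_module act
          linear_map_pointwise_add[OF summand_module act[OF r] act[OF s]] _ A])
       (use r s in \<open>simp_all add: summand_action_pure R.l_distr linear_map_add[OF MR_pure_head_linear]\<close>)
  show "summand_action K R \<Omega> X n (r \<otimes>\<^bsub>R\<^esub> s) A = summand_action K R \<Omega> X n r (summand_action K R \<Omega> X n s A)"
    by (rule summand_eq_on_pure[OF summand_module act linear_map_comp[OF act[OF s] act[OF r]] _ A])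
       (use r s in \<open>simp_all add: summand_action_pure R.m_assoc tuple\<close>)
qed

lemma summand_action_one:
  assumes A: "A \<in> carrier (MR_summand K R \<Omega> X n)"
  shows "summand_action K R \<Omega> X n \<one>\<^bsub>R\<^esub> A = A"
  by (rule summand_eq_on_pure[OF summand_module summand_action_linear _ _ A])
     (simp_all add: summand_action_pure linear_map_def)

lemma MR_scale_linear:
  assumes r: "r \<in> carrier R"
  shows "linear_map K (MR_sum K R \<Omega> X) (MR_sum K R \<Omega> X) (\<lambda>u. r \<odot>\<^bsub>MR K R \<Omega> X\<^esub> u)"
  unfolding MR_simps
  by (rule direct_sum_map_linear[OF K_cring summand_module summand_module summand_action_linear[OF r]])

lemma MR_scalar:
  assumes c: "c \<in> carrier K" and u: "u \<in> carrier (MR_sum K R \<Omega> X)"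
  shows "(c \<odot>\<^bsub>R\<^esub> \<one>\<^bsub>R\<^esub>) \<odot>\<^bsub>MR K R \<Omega> X\<^esub> u = c \<odot>\<^bsub>MR_sum K R \<Omega> X\<^esub> u"
  using direct_sum_component[OF u]
  by (auto simp: MR_simps direct_sum_ops summand_action_scalar[OF c] intro!: restrict_ext)

lemma MR_left_module: "left_module R (MR K R \<Omega> X)"
proof -
  interpret D: module K "MR_sum K R \<Omega> X" by (rule MR_sum_module)
  have ag: "abelian_group (MR K R \<Omega> X)"
    by (rule abelian_group_transfer[OF D.abelian_group_axioms]) (simp_all add: MR_simps fun_eq_iff)
  note comp = direct_sum_component
  show ?thesis
  proof (intro left_module.intro left_module_axioms.intro ag R.ring_axioms)
    show scl: "r \<odot>\<^bsub>MR K R \<Omega> X\<^esub> u \<in> carrier (MR K R \<Omega> X)"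
      if "r \<in> carrier R" "u \<in> carrier (MR K R \<Omega> X)" for r u
      using linear_map_closed[OF MR_scale_linear] that by (simp add: MR_simps(1))
    show "r \<odot>\<^bsub>MR K R \<Omega> X\<^esub> (u \<oplus>\<^bsub>MR K R \<Omega> X\<^esub> v) =
        r \<odot>\<^bsub>MR K R \<Omega> X\<^esub> u \<oplus>\<^bsub>MR K R \<Omega> X\<^esub> r \<odot>\<^bsub>MR K R \<Omega> X\<^esub> v"
      if "r \<in> carrier R" "u \<in> carrier (MR K R \<Omega> X)" "v \<in> carrier (MR K R \<Omega> X)" for r u v
      using linear_map_add[OF MR_scale_linear] that by (simp add: MR_simps(1,3))
    fix r s u assume rs: "r \<in> carrier R" "s \<in> carrier R" and "u \<in> carrier (MR K R \<Omega> X)"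
    then have u: "u \<in> carrier (MR_sum K R \<Omega> X)" by (simp add: MR_simps)
    show "(r \<oplus>\<^bsub>R\<^esub> s) \<odot>\<^bsub>MR K R \<Omega> X\<^esub> u = r \<odot>\<^bsub>MR K R \<Omega> X\<^esub> u \<oplus>\<^bsub>MR K R \<Omega> X\<^esub> s \<odot>\<^bsub>MR K R \<Omega> X\<^esub> u"
      using rs comp[OF u] by (auto simp: MR_simps direct_sum_ops summand_action_laws intro!: restrict_ext)
    show "(r \<otimes>\<^bsub>R\<^esub> s) \<odot>\<^bsub>MR K R \<Omega> X\<^esub> u = r \<odot>\<^bsub>MR K R \<Omega> X\<^esub> (s \<odot>\<^bsub>MR K R \<Omega> X\<^esub> u)"
      using rs comp[OF u] by (auto simp: MR_simps summand_action_laws intro!: restrict_ext)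
  next
    fix u assume "u \<in> carrier (MR K R \<Omega> X)"
    then have u: "u \<in> carrier (MR_sum K R \<Omega> X)" by (simp add: MR_simps)
    show "\<one>\<^bsub>R\<^esub> \<odot>\<^bsub>MR K R \<Omega> X\<^esub> u = u"
    proof (rule direct_sum_eqI)
      show "\<one>\<^bsub>R\<^esub> \<odot>\<^bsub>MR K R \<Omega> X\<^esub> u \<in> carrier (MR_sum K R \<Omega> X)"
        using linear_map_closed[OF MR_scale_linear u] by simp
    qed (use u comp[OF u] in \<open>simp_all add: MR_simps summand_action_one\<close>)
  qed
qed

text \<open>
  The operator shifts degrees by one, so it moves the support along \<open>Suc\<close>; this keeps it finite.
\<close>

lemma MR_operator_linear:
  assumes \<omega>: "\<omega> \<in> \<Omega>"
  shows "linear_map K (MR_sum K R \<Omega> X) (MR_sum K R \<Omega> X) (MR_operator K R \<Omega> X \<omega>)"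
proof -
  interpret S: module K "MR_summand K R \<Omega> X n" for n by (rule summand_module)
  note shift = summand_shift_linear[OF \<omega>]
  note comp = direct_sum_component[where I = "{1..}" and M = "MR_summand K R \<Omega> X"]
  show ?thesis
  proof (rule linear_mapI)
    fix u assume u: "u \<in> carrier (MR_sum K R \<Omega> X)"
    have "MR_operator K R \<Omega> X \<omega> u n \<in> carrier (MR_summand K R \<Omega> X n)" if "n \<ge> 1" for n
    proof (cases "n = 1")
      case False
      then have "summand_shift K R \<Omega> X (n - 1) \<omega> (u (n - 1)) \<in> carrier (MR_summand K R \<Omega> X (Suc (n - 1)))"
        using that comp[OF u, of "n - 1"] by (intro linear_map_closed[OF shift]) auto
      then show ?thesis using False that by (simp add: MR_operator_shift)
    qed (simp add: MR_operator_shift)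
    then have "MR_operator K R \<Omega> X \<omega> u \<in> (\<Pi>\<^sub>E n\<in>{1..}. carrier (MR_summand K R \<Omega> X n))"
      by (intro PiE_I) (auto simp: MR_operator_shift)
    moreover have "{n \<in> {1..}. MR_operator K R \<Omega> X \<omega> u n \<noteq> \<zero>\<^bsub>MR_summand K R \<Omega> X n\<^esub>} \<subseteq>
        Suc ` {n \<in> {1..}. u n \<noteq> \<zero>\<^bsub>MR_summand K R \<Omega> X n\<^esub>}"
    proof
      fix n assume n: "n \<in> {n \<in> {1..}. MR_operator K R \<Omega> X \<omega> u n \<noteq> \<zero>\<^bsub>MR_summand K R \<Omega> X n\<^esub>}"
      then have n1: "n \<noteq> 1" by (auto simp: MR_operator_shift)
      then have "u (n - 1) \<noteq> \<zero>\<^bsub>MR_summand K R \<Omega> X (n - 1)\<^esub>"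
        using n linear_map_zero[OF summand_module summand_module shift, of "n - 1"]
        by (auto simp: MR_operator_shift)
      then show "n \<in> Suc ` {n \<in> {1..}. u n \<noteq> \<zero>\<^bsub>MR_summand K R \<Omega> X n\<^esub>}"
        using n n1 by (intro image_eqI[of _ _ "n - 1"]) auto
    qed
    ultimately show "MR_operator K R \<Omega> X \<omega> u \<in> carrier (MR_sum K R \<Omega> X)"
      using u by (simp add: direct_sum_carrier finite_subset)
  next
    {
      fix u v assume u: "u \<in> carrier (MR_sum K R \<Omega> X)" and v: "v \<in> carrier (MR_sum K R \<Omega> X)"
      have "summand_shift K R \<Omega> X (n - 1) \<omega> (u (n - 1) \<oplus>\<^bsub>MR_summand K R \<Omega> X (n - 1)\<^esub> v (n - 1)) =
          summand_shift K R \<Omega> X (n - 1) \<omega> (u (n - 1)) \<oplus>\<^bsub>MR_summand K R \<Omega> X n\<^esub>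
          summand_shift K R \<Omega> X (n - 1) \<omega> (v (n - 1))" if "n \<ge> 2" for n
        using that linear_map_add[OF shift, of "n - 1"] comp[OF u, of "n - 1"] comp[OF v, of "n - 1"] by simp
      then show "MR_operator K R \<Omega> X \<omega> (u \<oplus>\<^bsub>MR_sum K R \<Omega> X\<^esub> v) =
          MR_operator K R \<Omega> X \<omega> u \<oplus>\<^bsub>MR_sum K R \<Omega> X\<^esub> MR_operator K R \<Omega> X \<omega> v"
        unfolding MR_operator_shift direct_sum_ops by (intro restrict_ext) (auto split: if_split)
    next
      fix c u assume c: "c \<in> carrier K" and u: "u \<in> carrier (MR_sum K R \<Omega> X)"
      have "summand_shift K R \<Omega> X (n - 1) \<omega> (c \<odot>\<^bsub>MR_summand K R \<Omega> X (n - 1)\<^esub> u (n - 1)) =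
          c \<odot>\<^bsub>MR_summand K R \<Omega> X n\<^esub> summand_shift K R \<Omega> X (n - 1) \<omega> (u (n - 1))" if "n \<ge> 2" for n
        using that c linear_map_smult[OF shift, of "n - 1"] comp[OF u, of "n - 1"] by simp
      then show "MR_operator K R \<Omega> X \<omega> (c \<odot>\<^bsub>MR_sum K R \<Omega> X\<^esub> u) = c \<odot>\<^bsub>MR_sum K R \<Omega> X\<^esub> MR_operator K R \<Omega> X \<omega> u"
        using c unfolding MR_operator_shift direct_sum_ops by (intro restrict_ext) (auto split: if_split)
    }
  qed
qed

lemma linear_map_restrict_MR:
  "linear_map K (restrict_scalars R (MR K R \<Omega> X)) N h \<longleftrightarrow> linear_map K (MR_sum K R \<Omega> X) N h"
  by (auto simp: linear_map_def MR_simps(1-3) MR_scalar)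

lemma MR_operated_module: "operated_module K R \<Omega> (MR K R \<Omega> X) (MR_operator K R \<Omega> X)"
proof -
  have "linear_map K (MR_sum K R \<Omega> X) (restrict_scalars R (MR K R \<Omega> X)) (MR_operator K R \<Omega> X \<omega>)" if "\<omega> \<in> \<Omega>" for \<omega>
    using MR_operator_linear[OF that] by (auto simp: linear_map_def MR_simps(1-3) MR_scalar Pi_iff)
  then show ?thesis
    by (simp add: operated_module_def MR_left_module linear_operator_iff linear_map_restrict_MR)
qed

lemma MR_scale_homogeneous:
  assumes "n \<ge> 1" "r \<in> carrier R"
  shows "r \<odot>\<^bsub>MR K R \<Omega> X\<^esub> homogeneous K R \<Omega> X n A = homogeneous K R \<Omega> X n (summand_action K R \<Omega> X n r A)"
  using assms linear_map_zero[OF summand_module summand_module summand_action_linear]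
  by (auto simp: MR_simps homogeneous_def single_def intro!: restrict_ext)

lemma MR_operator_homogeneous:
  assumes n: "n \<ge> 1" and \<omega>: "\<omega> \<in> \<Omega>"
  shows "MR_operator K R \<Omega> X \<omega> (homogeneous K R \<Omega> X n A) =
    homogeneous K R \<Omega> X (Suc n) (summand_shift K R \<Omega> X n \<omega> A)"
proof -
  have "summand_shift K R \<Omega> X (m - 1) \<omega> \<zero>\<^bsub>MR_summand K R \<Omega> X (m - 1)\<^esub> = \<zero>\<^bsub>MR_summand K R \<Omega> X m\<^esub>"
    if "m \<ge> 2" for m
    using that linear_map_zero[OF summand_module summand_module summand_shift_linear[OF \<omega>, of "m - 1"]]
    by simp
  then show ?thesis
    using n unfolding MR_operator_shift homogeneous_def single_def
    by (intro restrict_ext) (auto split: if_split)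
qed

lemma MR_gen_closed: "x \<in> X \<Longrightarrow> MR_gen K R \<Omega> X x \<in> carrier (MR K R \<Omega> X)"
  unfolding MR_gen_homogeneous MR_simps
  by (intro linear_map_closed[OF homogeneous_linear] MR_pure_closed)
     (use one_slot basis_slot in \<open>auto simp: factors_simps tensor_tuples_simps\<close>)

lemma tuples_first:
  assumes "t \<in> tensor_tuples (factors K R \<Omega> X (Suc 0))"
  obtains r g where "t = [Alg r, Gen g]" "r \<in> carrier R" "g \<in> carrier (free_module K X)"
  using assms by (auto simp: factors_simps tensor_tuples_simps carrier_module_copy)

lemma tuples_next:
  assumes "n \<ge> 1" "t \<in> tensor_tuples (factors K R \<Omega> X (Suc n))"
  obtains r p t' where "t = Alg r # Op p # t'" "r \<in> carrier R" "p \<in> carrier (free_module K \<Omega>)"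
    "t' \<in> tensor_tuples (factors K R \<Omega> X n)"
  using assms by (auto simp: factors_simps tensor_tuples_simps carrier_module_copy)

text \<open>
  \<open>M\<^sub>R(X)\<close> is generated by \<open>X\<close> as an operated module, by induction on the degree of a pure tensor:
  \<open>r \<otimes> x = r j(x)\<close> and \<open>r \<otimes> \<omega> \<otimes> t = r \<mm>'\<^sub>\<omega>(t)\<close>. The entries in the slots for \<open>X\<close> and \<open>\<Omega>\<close> reduce
  to basis elements by linearity.
\<close>

lemma MR_generated:
  assumes H: "submodule H K (MR_sum K R \<Omega> X)"
    and scale: "\<And>r u. r \<in> carrier R \<Longrightarrow> u \<in> H \<Longrightarrow> r \<odot>\<^bsub>MR K R \<Omega> X\<^esub> u \<in> H"
    and oper: "\<And>\<omega> u. \<omega> \<in> \<Omega> \<Longrightarrow> u \<in> H \<Longrightarrow> MR_operator K R \<Omega> X \<omega> u \<in> H"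
    and gen: "\<And>x. x \<in> X \<Longrightarrow> MR_gen K R \<Omega> X x \<in> H"
    and u: "u \<in> carrier (MR K R \<Omega> X)"
  shows "u \<in> H"
proof (rule MR_sum_spanned[OF H])
  show "u \<in> carrier (MR_sum K R \<Omega> X)" using u by (simp add: MR_simps)
  fix n :: nat and t assume "n \<ge> 1" "t \<in> tensor_tuples (factors K R \<Omega> X n)"
  then show "homogeneous K R \<Omega> X n (MR_pure K R \<Omega> X n t) \<in> H"
  proof (induction n arbitrary: t rule: dec_induct)
    case base
    then obtain r g where t: "t = [Alg r, Gen g]" "r \<in> carrier R" "g \<in> carrier (free_module K X)"
      using tuples_first by (metis One_nat_def)
    have lin: "linear_map K (free_module K X) (MR_summand K R \<Omega> X 1) (\<lambda>g. MR_pure K R \<Omega> X 1 [Alg r, Gen g])"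
      using MR_pure_multilinear[of 1] t(2)
      by (simp add: factors_simps multilinear_Cons slot_modules carrier_module_copy tensor_tuples_simps
          linear_map_from_copy inj_slots free_module_module K_cring)
    note lin' = linear_map_comp[OF lin homogeneous_linear[OF order.refl]]
    have basis: "basis_elem K X x \<in> {g \<in> carrier (free_module K X).
        homogeneous K R \<Omega> X 1 (MR_pure K R \<Omega> X 1 [Alg r, Gen g]) \<in> H}" if x: "x \<in> X" for x
    proof -
      have tup: "[Alg \<one>\<^bsub>R\<^esub>, Gen (basis_elem K X x)] \<in> tensor_tuples (factors K R \<Omega> X 1)"
        using one_slot basis_slot(2)[OF x] by (simp add: factors_simps tensor_tuples_simps)
      have "r \<odot>\<^bsub>MR K R \<Omega> X\<^esub> MR_gen K R \<Omega> X x \<in> H" using scale[OF t(2) gen[OF x]] .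
      then show ?thesis
        using t(2) tup by (simp add: MR_gen_homogeneous MR_scale_homogeneous summand_action_pure
            basis_elem_closed[OF K_cring x])
    qed
    show ?case
      using free_module_spanned[OF K_cring vimage_submodule[OF free_module_module[OF K_cring] MR_sum_module lin' H]
          _ t(3)] basis t(1) by simp
  next
    case (step n)
    then obtain r p t' where t: "t = Alg r # Op p # t'" "r \<in> carrier R" "p \<in> carrier (free_module K \<Omega>)"
      and t': "t' \<in> tensor_tuples (factors K R \<Omega> X n)"
      using tuples_next by metis
    have lin: "linear_map K (free_module K \<Omega>) (MR_summand K R \<Omega> X (Suc n))
        (\<lambda>p. MR_pure K R \<Omega> X (Suc n) (Alg r # Op p # t'))"
      using MR_pure_multilinear[of "Suc n"] t(2) t' step.hyps
      by (simp add: factors_simps multilinear_Cons slot_modules carrier_module_copy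
          linear_map_from_copy inj_slots free_module_module K_cring)
    have "Suc n \<ge> 1" by simp
    note lin' = linear_map_comp[OF lin homogeneous_linear[OF this]]
    have basis: "basis_elem K \<Omega> \<omega> \<in> {p \<in> carrier (free_module K \<Omega>).
        homogeneous K R \<Omega> X (Suc n) (MR_pure K R \<Omega> X (Suc n) (Alg r # Op p # t')) \<in> H}" if \<omega>: "\<omega> \<in> \<Omega>" for \<omega>
    proof -
      have tup: "Alg \<one>\<^bsub>R\<^esub> # Op (basis_elem K \<Omega> \<omega>) # t' \<in> tensor_tuples (factors K R \<Omega> X (Suc n))"
        using one_slot basis_slot(1)[OF \<omega>] t' step.hyps by (simp add: factors_simps tensor_tuples_simps)
      have "r \<odot>\<^bsub>MR K R \<Omega> X\<^esub> MR_operator K R \<Omega> X \<omega> (homogeneous K R \<Omega> X n (MR_pure K R \<Omega> X n t')) \<in> H"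
        by (rule scale[OF t(2) oper[OF \<omega> step.IH[OF t']]])
      then show ?thesis
        using t(2) t' tup step.hyps \<omega> by (simp add: MR_operator_homogeneous MR_scale_homogeneous
            summand_shift_pure summand_action_pure basis_elem_closed[OF K_cring])
    qed
    show ?case
      using free_module_spanned[OF K_cring vimage_submodule[OF free_module_module[OF K_cring] MR_sum_module lin' H]
          _ t(3)] basis t(1) by simp
  qed
qed

context
  fixes N :: "('r, 'n) module" and \<nn> :: "'w \<Rightarrow> 'n \<Rightarrow> 'n" and f :: "'x \<Rightarrow> 'n"
  assumes N: "operated_module K R \<Omega> N \<nn>" and f: "f \<in> X \<rightarrow> carrier N"
begin

lemma N_left_module: "left_module R N"
  using N by (simp add: operated_module_def)

lemma N_operator_linear:
  "\<omega> \<in> \<Omega> \<Longrightarrow> linear_map K (restrict_scalars R N) (restrict_scalars R N) (\<nn> \<omega>)"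
  using N by (simp add: operated_module_def linear_operator_iff)

interpretation N: left_module R N by (rule N_left_module)

lemmas N_module = restrict_scalars_module[OF R N_left_module]

text \<open>
  Induction on the degree: passing to the next one composes the evaluation of the tail with maps
  that are linear in the tail, in the operator slot and in the leading algebra element.
\<close>

lemma eval_word_multilinear:
  "n \<ge> 1 \<Longrightarrow> multilinear K (factors K R \<Omega> X n) (restrict_scalars R N) (eval_word K R \<Omega> X N \<nn> f)"
proof (induction n rule: dec_induct)
  let ?N = "restrict_scalars R N"
  case base
  have fl: "linear_map K (free_module K X) ?N (free_lift K X ?N f)"
    using f by (intro free_lift_linear[OF N_module]) auto
  have "linear_map K R ?N (\<lambda>r. r \<odot>\<^bsub>N\<^esub> free_lift K X ?N f g)" if "g \<in> carrier (free_module K X)" for g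
    using left_module_orbit_linear[OF R N_left_module] linear_map_closed[OF fl that] by simp
  moreover have "linear_map K (free_module K X) ?N (\<lambda>g. r \<odot>\<^bsub>N\<^esub> free_lift K X ?N f g)" if "r \<in> carrier R" for r
    using linear_map_comp[OF fl left_module_scale_linear[OF R N_left_module that]] .
  ultimately show ?case
    using linear_map_closed[OF fl] N.smult_closed
    by (auto simp: factors_simps multilinear_Cons multilinear_Nil slot_modules carrier_module_copy
        tensor_tuples_simps linear_map_from_copy inj_slots R_module free_module_module K_cring)
next
  let ?N = "restrict_scalars R N" and ?E = "eval_word K R \<Omega> X N \<nn> f"
  case (step n)
  have op_closed: "\<nn> \<omega> v \<in> carrier ?N" if "\<omega> \<in> \<Omega>" "v \<in> carrier N" for \<omega> v
    using linear_map_closed[OF N_operator_linear[OF that(1)]] that(2) by simp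
  have E: "?E t \<in> carrier N" if "t \<in> tensor_tuples (factors K R \<Omega> X n)" for t
    using multilinear_closed[OF step.IH that] by simp
  have fl: "linear_map K (free_module K \<Omega>) ?N (free_lift K \<Omega> ?N (\<lambda>\<omega>. \<nn> \<omega> v))" if "v \<in> carrier N" for v
    using op_closed that by (intro free_lift_linear[OF N_module]) auto
  have "multilinear K (factors K R \<Omega> X n) ?N (\<lambda>t. ?E (Alg r # Op p # t))"
    if r: "r \<in> carrier R" and p: "p \<in> carrier (free_module K \<Omega>)" for r p
    using multilinear_comp[OF step.IH linear_map_comp[OF
          free_lift_linear_param[OF N_module N_module N_operator_linear p]
          left_module_scale_linear[OF R N_left_module r]]]
    by simp
  moreover have "linear_map K (free_module K \<Omega>) ?N (\<lambda>p. ?E (Alg r # Op p # t))"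
    if r: "r \<in> carrier R" and t: "t \<in> tensor_tuples (factors K R \<Omega> X n)" for r t
    using linear_map_comp[OF fl[OF E[OF t]] left_module_scale_linear[OF R N_left_module r]] by simp
  moreover have "linear_map K R ?N (\<lambda>r. ?E (Alg r # Op p # t))"
    if p: "p \<in> carrier (free_module K \<Omega>)" and t: "t \<in> tensor_tuples (factors K R \<Omega> X n)" for p t
    using left_module_orbit_linear[OF R N_left_module] linear_map_closed[OF fl[OF E[OF t]] p] by simp
  ultimately show ?case
    using step.hyps
    by (auto simp: factors_simps multilinear_Cons slot_modules carrier_module_copy
        tensor_tuples_simps linear_map_from_copy inj_slots R_module free_module_module K_cring)
qed

definition MR_extension where
  "MR_extension = sum_lift {1..} (MR_summand K R \<Omega> X) (restrict_scalars R N)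
    (\<lambda>n. tensor_lift K (factors K R \<Omega> X n) (restrict_scalars R N) (eval_word K R \<Omega> X N \<nn> f))"

lemma MR_extension_linear: "linear_map K (MR_sum K R \<Omega> X) (restrict_scalars R N) MR_extension"
  and MR_extension_pure: "n \<ge> 1 \<Longrightarrow> t \<in> tensor_tuples (factors K R \<Omega> X n) \<Longrightarrow>
    MR_extension (homogeneous K R \<Omega> X n (MR_pure K R \<Omega> X n t)) = eval_word K R \<Omega> X N \<nn> f t"
proof -
  have lin: "linear_map K (MR_summand K R \<Omega> X n) (restrict_scalars R N)
      (tensor_lift K (factors K R \<Omega> X n) (restrict_scalars R N) (eval_word K R \<Omega> X N \<nn> f))"
    if "n \<in> {1..}" for n
    using tensor_lift_linear[OF K_cring factors_modules N_module eval_word_multilinear] that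
    by (simp add: MR_summand_def)
  show "linear_map K (MR_sum K R \<Omega> X) (restrict_scalars R N) MR_extension"
    unfolding MR_extension_def by (rule sum_lift_linear[OF K_cring summand_module N_module lin])
  show "MR_extension (homogeneous K R \<Omega> X n (MR_pure K R \<Omega> X n t)) = eval_word K R \<Omega> X N \<nn> f t"
    if n: "n \<ge> 1" and t: "t \<in> tensor_tuples (factors K R \<Omega> X n)"
  proof -
    have "MR_extension (homogeneous K R \<Omega> X n (MR_pure K R \<Omega> X n t)) =
        tensor_lift K (factors K R \<Omega> X n) (restrict_scalars R N) (eval_word K R \<Omega> X N \<nn> f) (MR_pure K R \<Omega> X n t)"
      unfolding MR_extension_def homogeneous_def
      by (rule sum_lift_single[OF summand_module N_module lin]) (use n MR_pure_closed[OF t] in auto)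
    also have "\<dots> = eval_word K R \<Omega> X N \<nn> f t"
      unfolding MR_pure_def
      by (rule tensor_lift_pure[OF K_cring factors_modules N_module eval_word_multilinear[OF n] t])
    finally show ?thesis .
  qed
qed

lemma linear_eq_on_homogeneous_pure:
  assumes "linear_map K (MR_sum K R \<Omega> X) (restrict_scalars R N) g" "linear_map K (MR_sum K R \<Omega> X) (restrict_scalars R N) h"
    and "\<And>n t. n \<ge> 1 \<Longrightarrow> t \<in> tensor_tuples (factors K R \<Omega> X n) \<Longrightarrow>
      g (homogeneous K R \<Omega> X n (MR_pure K R \<Omega> X n t)) = h (homogeneous K R \<Omega> X n (MR_pure K R \<Omega> X n t))"
    and "u \<in> carrier (MR_sum K R \<Omega> X)"
  shows "g u = h u"
proof -
  have closed: "homogeneous K R \<Omega> X n (MR_pure K R \<Omega> X n t) \<in> carrier (MR_sum K R \<Omega> X)"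
    if "n \<ge> 1" "t \<in> tensor_tuples (factors K R \<Omega> X n)" for n t
    using that by (intro linear_map_closed[OF homogeneous_linear] MR_pure_closed) auto
  have "u \<in> {u \<in> carrier (MR_sum K R \<Omega> X). g u = h u}"
    by (rule MR_sum_spanned[OF equalizer_submodule[OF MR_sum_module N_module assms(1,2)] _ assms(4)])
       (use assms(3) closed in auto)
  then show ?thesis by simp
qed

text \<open>
  Homogeneous pure tensors suffice by linearity. There \<open>r\<close> changes the first entry \<open>s\<close> to \<open>r s\<close>, and
  the evaluation of the word starts with the action of that entry.
\<close>

lemma MR_extension_scale:
  assumes r: "r \<in> carrier R" and u: "u \<in> carrier (MR K R \<Omega> X)"
  shows "MR_extension (r \<odot>\<^bsub>MR K R \<Omega> X\<^esub> u) = r \<odot>\<^bsub>N\<^esub> MR_extension u"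
proof (rule linear_eq_on_homogeneous_pure[OF linear_map_comp[OF MR_scale_linear[OF r] MR_extension_linear]
      linear_map_comp[OF MR_extension_linear left_module_scale_linear[OF R N_left_module r]] _ u[unfolded MR_simps]])
  fix n :: nat and t assume n: "n \<ge> 1" and t: "t \<in> tensor_tuples (factors K R \<Omega> X n)"
  obtain Ms where Ms: "factors K R \<Omega> X n = module_copy Alg R # Ms" by (rule factors_obtain_tail)
  obtain s t' where t': "t = Alg s # t'" "s \<in> carrier R" "t' \<in> tensor_tuples Ms"
    using t by (auto simp: Ms tensor_tuples_simps carrier_module_copy)
  have rs: "Alg (r \<otimes>\<^bsub>R\<^esub> s) # t' \<in> tensor_tuples (factors K R \<Omega> X n)"
    using t' r by (simp add: Ms tensor_tuples_simps carrier_module_copy)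
  have "MR_extension (r \<odot>\<^bsub>MR K R \<Omega> X\<^esub> homogeneous K R \<Omega> X n (MR_pure K R \<Omega> X n t)) =
      eval_word K R \<Omega> X N \<nn> f (Alg (r \<otimes>\<^bsub>R\<^esub> s) # t')"
    using n r t rs MR_extension_pure[OF n rs]
    by (simp add: t' MR_scale_homogeneous summand_action_pure)
  also have "\<dots> = r \<odot>\<^bsub>N\<^esub> eval_word K R \<Omega> X N \<nn> f t"
  proof (cases "n = 1")
    case True
    then obtain g where g: "t = [Alg s, Gen g]" "g \<in> carrier (free_module K X)"
      using t t' by (auto simp: factors_simps tensor_tuples_simps carrier_module_copy)
    have "linear_map K (free_module K X) (restrict_scalars R N) (free_lift K X (restrict_scalars R N) f)"
      using f by (intro free_lift_linear[OF N_module]) auto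
    then have "free_lift K X (restrict_scalars R N) f g \<in> carrier N"
      using linear_map_closed g(2) by fastforce
    then show ?thesis using g t' r by (simp add: N.smult_assoc1)
  next
    case False
    then obtain m where m: "n = Suc m" "m \<ge> 1" using n by (cases n) auto
    obtain p t'' where p: "t = Alg s # Op p # t''" "p \<in> carrier (free_module K \<Omega>)"
      "t'' \<in> tensor_tuples (factors K R \<Omega> X m)"
      using tuples_next[OF m(2)] t t'(1) m(1) by (metis list.inject)
    have "eval_word K R \<Omega> X N \<nn> f t'' \<in> carrier (restrict_scalars R N)"
      by (rule multilinear_closed[OF eval_word_multilinear[OF m(2)] p(3)])
    then have "linear_map K (free_module K \<Omega>) (restrict_scalars R N)
        (free_lift K \<Omega> (restrict_scalars R N) (\<lambda>\<omega>. \<nn> \<omega> (eval_word K R \<Omega> X N \<nn> f t'')))"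
      by (intro free_lift_linear[OF N_module] linear_map_closed[OF N_operator_linear])
    then have "free_lift K \<Omega> (restrict_scalars R N) (\<lambda>\<omega>. \<nn> \<omega> (eval_word K R \<Omega> X N \<nn> f t'')) p \<in> carrier N"
      using linear_map_closed p(2) by fastforce
    then show ?thesis using p t' r by (simp add: N.smult_assoc1)
  qed
  finally show "MR_extension (r \<odot>\<^bsub>MR K R \<Omega> X\<^esub> homogeneous K R \<Omega> X n (MR_pure K R \<Omega> X n t)) =
      r \<odot>\<^bsub>N\<^esub> MR_extension (homogeneous K R \<Omega> X n (MR_pure K R \<Omega> X n t))"
    by (simp add: MR_extension_pure[OF n t])
qed

lemma MR_extension_operator:
  assumes \<omega>: "\<omega> \<in> \<Omega>" and u: "u \<in> carrier (MR K R \<Omega> X)"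
  shows "MR_extension (MR_operator K R \<Omega> X \<omega> u) = \<nn> \<omega> (MR_extension u)"
proof (rule linear_eq_on_homogeneous_pure[OF linear_map_comp[OF MR_operator_linear[OF \<omega>] MR_extension_linear]
      linear_map_comp[OF MR_extension_linear N_operator_linear[OF \<omega>]] _ u[unfolded MR_simps]])
  fix n :: nat and t assume n: "n \<ge> 1" and t: "t \<in> tensor_tuples (factors K R \<Omega> X n)"
  let ?E = "eval_word K R \<Omega> X N \<nn> f"
  have tup: "Alg \<one>\<^bsub>R\<^esub> # Op (basis_elem K \<Omega> \<omega>) # t \<in> tensor_tuples (factors K R \<Omega> X (Suc n))"
    using one_slot basis_slot(1)[OF \<omega>] t n by (simp add: factors_simps tensor_tuples_simps)
  have E: "?E t \<in> carrier (restrict_scalars R N)"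
    by (rule multilinear_closed[OF eval_word_multilinear[OF n] t])
  note op_closed = linear_map_closed[OF N_operator_linear E]
  have "MR_extension (MR_operator K R \<Omega> X \<omega> (homogeneous K R \<Omega> X n (MR_pure K R \<Omega> X n t))) =
      ?E (Alg \<one>\<^bsub>R\<^esub> # Op (basis_elem K \<Omega> \<omega>) # t)"
    using n t \<omega> MR_extension_pure[OF _ tup] by (simp add: MR_operator_homogeneous summand_shift_pure)
  also have "\<dots> = \<nn> \<omega> (?E t)"
    using free_lift_basis[OF N_module op_closed \<omega>] op_closed[OF \<omega>] by (simp add: N.smult_one)
  finally show "MR_extension (MR_operator K R \<Omega> X \<omega> (homogeneous K R \<Omega> X n (MR_pure K R \<Omega> X n t))) =
      \<nn> \<omega> (MR_extension (homogeneous K R \<Omega> X n (MR_pure K R \<Omega> X n t)))"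
    by (simp add: MR_extension_pure[OF n t])
qed

lemma MR_extension_gen:
  assumes x: "x \<in> X"
  shows "MR_extension (MR_gen K R \<Omega> X x) = f x"
proof -
  have "[Alg \<one>\<^bsub>R\<^esub>, Gen (basis_elem K X x)] \<in> tensor_tuples (factors K R \<Omega> X 1)"
    using one_slot basis_slot(2)[OF x] by (simp add: factors_simps tensor_tuples_simps)
  then have "MR_extension (MR_gen K R \<Omega> X x) = \<one>\<^bsub>R\<^esub> \<odot>\<^bsub>N\<^esub> free_lift K X (restrict_scalars R N) f (basis_elem K X x)"
    using MR_extension_pure[of 1 "[Alg \<one>\<^bsub>R\<^esub>, Gen (basis_elem K X x)]"] by (simp add: MR_gen_homogeneous)
  also have "free_lift K X (restrict_scalars R N) f (basis_elem K X x) = f x"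
    by (rule free_lift_basis[OF N_module _ x]) (use f in auto)
  finally show ?thesis using f x N.smult_one[of "f x"] by (simp add: Pi_iff)
qed

lemma operated_hom_linear:
  assumes "\<phi> \<in> operated_hom R \<Omega> (MR K R \<Omega> X) (MR_operator K R \<Omega> X) N \<nn>"
  shows "linear_map K (MR_sum K R \<Omega> X) (restrict_scalars R N) \<phi>"
  using assms unfolding linear_map_restrict_MR[symmetric]
  by (auto simp: operated_hom_def intro!: linear_mapI)

text \<open>
  The set where two homomorphisms agree is a \<open>K\<close>-submodule stable under \<open>R\<close> and the operators, so
  \<open>MR_generated\<close> applies to it.
\<close>

lemma operated_hom_unique:
  assumes \<phi>: "\<phi> \<in> operated_hom R \<Omega> (MR K R \<Omega> X) (MR_operator K R \<Omega> X) N \<nn>"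
    and \<psi>: "\<psi> \<in> operated_hom R \<Omega> (MR K R \<Omega> X) (MR_operator K R \<Omega> X) N \<nn>"
    and eq: "\<And>x. x \<in> X \<Longrightarrow> \<phi> (MR_gen K R \<Omega> X x) = \<psi> (MR_gen K R \<Omega> X x)"
    and u: "u \<in> carrier (MR K R \<Omega> X)"
  shows "\<phi> u = \<psi> u"
proof -
  interpret M: left_module R "MR K R \<Omega> X" by (rule MR_left_module)
  have "u \<in> {u \<in> carrier (MR_sum K R \<Omega> X). \<phi> u = \<psi> u}"
  proof (rule MR_generated[OF equalizer_submodule[OF MR_sum_module N_module
          operated_hom_linear[OF \<phi>] operated_hom_linear[OF \<psi>]] _ _ _ u])
    show "MR_gen K R \<Omega> X x \<in> {u \<in> carrier (MR_sum K R \<Omega> X). \<phi> u = \<psi> u}" if "x \<in> X" for x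
      using that MR_gen_closed eq by (simp add: MR_simps(1))
    fix v assume "v \<in> {u \<in> carrier (MR_sum K R \<Omega> X). \<phi> u = \<psi> u}"
    then have v: "v \<in> carrier (MR K R \<Omega> X)" "\<phi> v = \<psi> v" by (simp_all add: MR_simps(1))
    show "r \<odot>\<^bsub>MR K R \<Omega> X\<^esub> v \<in> {u \<in> carrier (MR_sum K R \<Omega> X). \<phi> u = \<psi> u}" if "r \<in> carrier R" for r
      using that v \<phi> \<psi> M.smult_closed by (auto simp: operated_hom_def MR_simps(1))
    show "MR_operator K R \<Omega> X \<omega> v \<in> {u \<in> carrier (MR_sum K R \<Omega> X). \<phi> u = \<psi> u}" if "\<omega> \<in> \<Omega>" for \<omega>
      using that v \<phi> \<psi> linear_map_closed[OF MR_operator_linear[OF that]]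
      by (auto simp: operated_hom_def MR_simps(1))
  qed
  then show ?thesis by simp
qed

lemma MR_extension_operated_hom:
  "restrict MR_extension (carrier (MR K R \<Omega> X)) \<in> operated_hom R \<Omega> (MR K R \<Omega> X) (MR_operator K R \<Omega> X) N \<nn>"
proof -
  interpret M: left_module R "MR K R \<Omega> X" by (rule MR_left_module)
  have op: "MR_operator K R \<Omega> X \<omega> u \<in> carrier (MR K R \<Omega> X)" if "\<omega> \<in> \<Omega>" "u \<in> carrier (MR K R \<Omega> X)" for \<omega> u
    using linear_map_closed[OF MR_operator_linear] that by (simp add: MR_simps(1))
  have add: "MR_extension (u \<oplus>\<^bsub>MR K R \<Omega> X\<^esub> v) = MR_extension u \<oplus>\<^bsub>N\<^esub> MR_extension v"
    if "u \<in> carrier (MR K R \<Omega> X)" "v \<in> carrier (MR K R \<Omega> X)" for u v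
    using linear_map_add[OF MR_extension_linear, of u v] that by (simp add: MR_simps(1,3))
  have closed: "MR_extension u \<in> carrier N" if "u \<in> carrier (MR K R \<Omega> X)" for u
    using linear_map_closed[OF MR_extension_linear, of u] that by (simp add: MR_simps(1))
  show ?thesis
    unfolding operated_hom_def
    using closed op
    by (auto simp: add M.smult_closed MR_extension_scale MR_extension_operator)
qed

lemma MR_universal:
  "\<exists>!\<phi>. \<phi> \<in> extensional (carrier (MR K R \<Omega> X)) \<and>
    \<phi> \<in> operated_hom R \<Omega> (MR K R \<Omega> X) (MR_operator K R \<Omega> X) N \<nn> \<and>
    (\<forall>x\<in>X. \<phi> (MR_gen K R \<Omega> X x) = f x)"
proof (rule ex1I)
  show "restrict MR_extension (carrier (MR K R \<Omega> X)) \<in> extensional (carrier (MR K R \<Omega> X)) \<and>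
    restrict MR_extension (carrier (MR K R \<Omega> X)) \<in> operated_hom R \<Omega> (MR K R \<Omega> X) (MR_operator K R \<Omega> X) N \<nn> \<and>
    (\<forall>x\<in>X. restrict MR_extension (carrier (MR K R \<Omega> X)) (MR_gen K R \<Omega> X x) = f x)"
    using MR_extension_operated_hom by (simp add: MR_extension_gen MR_gen_closed)
  fix \<phi> assume \<phi>: "\<phi> \<in> extensional (carrier (MR K R \<Omega> X)) \<and>
    \<phi> \<in> operated_hom R \<Omega> (MR K R \<Omega> X) (MR_operator K R \<Omega> X) N \<nn> \<and>
    (\<forall>x\<in>X. \<phi> (MR_gen K R \<Omega> X x) = f x)"
  show "\<phi> = restrict MR_extension (carrier (MR K R \<Omega> X))"
  proof (rule extensionalityI)
    show "\<phi> u = restrict MR_extension (carrier (MR K R \<Omega> X)) u" if "u \<in> carrier (MR K R \<Omega> X)" for u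
      by (rule operated_hom_unique[OF _ MR_extension_operated_hom _ that])
         (use \<phi> in \<open>auto simp: MR_extension_gen MR_gen_closed\<close>)
  qed (use \<phi> in auto)
qed

end

end

theorem proposition2p11:
  fixes K :: "('k, 'c) ring_scheme" and R :: "('k, 'r, 'd) module_scheme"
    and \<Omega> :: "'w set" and P :: "'w \<Rightarrow> 'r \<Rightarrow> 'r" and X :: "'x set"
  assumes "operated_algebra K R \<Omega> P" and "\<Omega> \<noteq> {}"
  shows "operated_module K R \<Omega> (MR K R \<Omega> X) (MR_operator K R \<Omega> X) \<and>
    free_operated_module TYPE('n) K R \<Omega> X (MR K R \<Omega> X) (MR_operator K R \<Omega> X) (MR_gen K R \<Omega> X)"
proof -
  have R: "assoc_algebra K R" using assms(1) by (simp add: operated_algebra_def)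
  show ?thesis
    unfolding free_operated_module_def
    by (intro conjI allI impI Pi_I MR_operated_module[OF R] MR_universal[OF R] MR_gen_closed[OF R]) auto
qed

end
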